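(* Let $n\ge 3$, $\epsilon\in\{-1,1\}$, let $\phi:U\subset\mathbb{R}^{n-1}\to\mathbb{R}^n$ be the immersion of an $\epsilon$-quadric, and let $\gamma_1,\gamma_2$ be smooth functions on an open interval $I$. If $$\epsilon\,\dot\gamma_2\gamma_1(\ddot\gamma_1\dot\gamma_2-\ddot\gamma_2\dot\gamma_1)<0$$ on $I$, then $F:I\times U\to\mathbb{A}^{n+1}$, $F(t,\vec u)=(\gamma_1(t)\phi(\vec u),\gamma_2(t))$, is a convex affine hypersurface with a pointwise $SO(n-1)$ symmetry. Its affine normal is $$\xi=\mu\,(\phi,0)+\nu\,\partial_t,\qquad \partial_t=\frac{\partial F}{\partial t}=(\dot\gamma_1\phi,\dot\gamma_2),$$ where $\mu,\nu$ are functions of $t$ determined, for an appropriate choice of sign, by $$\dot\mu=-\nu\,\frac{\ddot\gamma_1\dot\gamma_2-\ddot\gamma_2\dot\gamma_1}{\dot\gamma_2},\qquad \mu^{n+2}\gamma_1^{n-1}\dot\gamma_2^3=\pm\epsilon^{n-1}\left(\ddot\gamma_1\dot\gamma_2-\ddot\gamma_2\dot\gamma_1\right).$$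
   Context: $\mathbb{A}^{n+1}$ is $\mathbb{R}^{n+1}$ with its flat connection $D$ and the determinant as volume form. For an immersed hypersurface with transversal vector field $\xi$ write $D_XY=\nabla_XY+h(X,Y)\xi$, $D_X\xi=-SX+\tau(X)\xi$, and $\omega(X_1,\dots,X_n)=\det(X_1,\dots,X_n,\xi)$. If $h$ is non-degenerate, the affine normal is the transversal field $\xi$, unique up to sign, with $\nabla\omega=0$ (equivalently $\tau=0$) and $\omega(X_1,\dots,X_n)^2=|\det(h(X_i,X_j))|$ for tangent frames. The hypersurface is convex (strictly locally convex) when $h$ is definite, and the sign of $\xi$ is then chosen so that $h$ is positive definite. With this $\xi$, $h$ is the affine metric, $S$ the shape operator, $\nabla$ the Blaschke connection, $\hat\nabla$ the Levi-Civita connection of $h$, and $K(X,Y)=\nabla_XY-\hat\nabla_XY$ the difference tensor. Pointwise $SO(n-1)$ symmetry: at every point $p$ there is an $h$-unit tangent vector $X_1$ such that every linear automorphism $g$ of the tangent space at $p$ with $gX_1=X_1$ which restricts to an element of $SO(\langle X_1\rangle^\perp)$ satisfies $S(gX)=gS(X)$ and $K(gX,gY)=gK(X,Y)$ for all tangent $X,Y$. For $\epsilon=\pm1$, an $\epsilon$-quadric in $\mathbb{R}^n$ is a convex quadratic hypersurface of affine mean curvature $\epsilon$, centred at the origin: up to an equi-affine linear transformation it is an open part of the unit sphere ($\epsilon=1$), or of one sheet of $x_1^2+\dots+x_{n-1}^2-x_n^2=-1$ ($\epsilon=-1$). Dots denote derivatives with respect to $t$. *)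

theory Defs
  imports "HOL-Analysis.Analysis"
begin

text \<open>
  The affine space of dimension \<open>n + 1\<close> is \<open>(real ^ 'n) \<times> real\<close> with \<open>n = CARD('n)\<close>. A hypersurface is given
  by a parametrisation \<open>F\<close> on an open set \<open>M\<close> of a Euclidean space \<open>'p\<close> with \<open>DIM('p) = n\<close>. Its
  tangent space at \<open>p\<close> is identified with \<open>'p\<close> through the differential of \<open>F\<close>, so that tangent
  vectors are elements of \<open>'p\<close> and tangent vector fields are functions \<open>'p \<Rightarrow> 'p\<close>. All fields are
  total functions of which only the values on \<open>M\<close> matter.
\<close>

subsection \<open>Smooth maps and immersions\<close>

primrec Ck_on :: "nat \<Rightarrow> 'p::real_normed_vector set \<Rightarrow> ('p \<Rightarrow> 'v::real_normed_vector) \<Rightarrow> bool" where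
  "Ck_on 0 M f \<longleftrightarrow> continuous_on M f"
| "Ck_on (Suc k) M f \<longleftrightarrow>
     (\<forall>p\<in>M. f differentiable (at p)) \<and> (\<forall>v. Ck_on k M (\<lambda>p. frechet_derivative f (at p) v))"

text \<open>Only used for open \<open>M\<close> in a finite-dimensional space, where it is the usual notion.\<close>

definition smooth_on :: "'p::real_normed_vector set \<Rightarrow> ('p \<Rightarrow> 'v::real_normed_vector) \<Rightarrow> bool" where
  "smooth_on M f \<longleftrightarrow> (\<forall>k. Ck_on k M f)"

definition immersion_on :: "'p::real_normed_vector set \<Rightarrow> ('p \<Rightarrow> 'v::real_normed_vector) \<Rightarrow> bool" where
  "immersion_on M F \<longleftrightarrow> smooth_on M F \<and> (\<forall>p\<in>M. inj (frechet_derivative F (at p)))"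

subsection \<open>Induced objects of a transversal field\<close>

definition transversal_on ::
    "'p::real_normed_vector set \<Rightarrow> ('p \<Rightarrow> 'v::real_normed_vector) \<Rightarrow> ('p \<Rightarrow> 'v) \<Rightarrow> bool" where
  "transversal_on M F \<xi> \<longleftrightarrow> (\<forall>p\<in>M. \<xi> p \<notin> range (frechet_derivative F (at p)))"

text \<open>The two components of \<open>w = dF\<^sub>p(v) + c \<xi>(p)\<close>.\<close>

definition tangential ::
    "('p::real_normed_vector \<Rightarrow> 'v::real_normed_vector) \<Rightarrow> ('p \<Rightarrow> 'v) \<Rightarrow> 'p \<Rightarrow> 'v \<Rightarrow> 'p" where
  "tangential F \<xi> p w = (THE v. \<exists>c. w = frechet_derivative F (at p) v + c *\<^sub>R \<xi> p)"

definition transverse ::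
    "('p::real_normed_vector \<Rightarrow> 'v::real_normed_vector) \<Rightarrow> ('p \<Rightarrow> 'v) \<Rightarrow> 'p \<Rightarrow> 'v \<Rightarrow> real" where
  "transverse F \<xi> p w = (THE c. \<exists>v. w = frechet_derivative F (at p) v + c *\<^sub>R \<xi> p)"

definition flat_deriv ::
    "('p::real_normed_vector \<Rightarrow> 'v::real_normed_vector) \<Rightarrow> ('p \<Rightarrow> 'p) \<Rightarrow> ('p \<Rightarrow> 'p) \<Rightarrow> 'p \<Rightarrow> 'v" where
  "flat_deriv F X Y p =
     frechet_derivative (\<lambda>q. frechet_derivative F (at q) (Y q)) (at p) (X p)"

definition induced_conn ::
    "('p::real_normed_vector \<Rightarrow> 'v::real_normed_vector) \<Rightarrow> ('p \<Rightarrow> 'v) \<Rightarrow> ('p \<Rightarrow> 'p) \<Rightarrow> ('p \<Rightarrow> 'p) \<Rightarrow> 'p \<Rightarrow> 'p" where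
  "induced_conn F \<xi> X Y p = tangential F \<xi> p (flat_deriv F X Y p)"

text \<open>The form \<open>h\<close> is a tensor, so its value on two tangent vectors at \<open>p\<close> is computed with their
  constant extensions in the parameter space.\<close>

definition affine_metric ::
    "('p::real_normed_vector \<Rightarrow> 'v::real_normed_vector) \<Rightarrow> ('p \<Rightarrow> 'v) \<Rightarrow> 'p \<Rightarrow> 'p \<Rightarrow> 'p \<Rightarrow> real" where
  "affine_metric F \<xi> p v w = transverse F \<xi> p (flat_deriv F (\<lambda>_. v) (\<lambda>_. w) p)"

definition shape_op ::
    "('p::real_normed_vector \<Rightarrow> 'v::real_normed_vector) \<Rightarrow> ('p \<Rightarrow> 'v) \<Rightarrow> 'p \<Rightarrow> 'p \<Rightarrow> 'p" where
  "shape_op F \<xi> p v = - tangential F \<xi> p (frechet_derivative \<xi> (at p) v)"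

subsection \<open>Volume forms, convexity and the affine normal\<close>

text \<open>The determinant of \<open>n + 1\<close> vectors, the coordinate \<open>None\<close> being the last one.\<close>

definition ambient_det :: "('n::finite option \<Rightarrow> (real ^ 'n) \<times> real) \<Rightarrow> real" where
  "ambient_det V =
     det (\<chi> a b. case b of Some k \<Rightarrow> fst (V a) $ k | None \<Rightarrow> snd (V a))"

definition induced_vol ::
    "('p::real_normed_vector \<Rightarrow> (real ^ 'n::finite) \<times> real) \<Rightarrow> ('p \<Rightarrow> (real ^ 'n) \<times> real) \<Rightarrow> 'p \<Rightarrow> ('n \<Rightarrow> 'p) \<Rightarrow> real" where
  "induced_vol F \<xi> p V =
     ambient_det (\<lambda>a. case a of Some i \<Rightarrow> frechet_derivative F (at p) (V i) | None \<Rightarrow> \<xi> p)"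

definition equiaffine_on ::
    "'p::real_normed_vector set \<Rightarrow> ('p \<Rightarrow> (real ^ 'n::finite) \<times> real) \<Rightarrow> ('p \<Rightarrow> (real ^ 'n) \<times> real) \<Rightarrow> bool" where
  "equiaffine_on M F \<xi> \<longleftrightarrow>
     (\<forall>X (Y :: 'n \<Rightarrow> 'p \<Rightarrow> 'p). smooth_on M X \<longrightarrow> (\<forall>i. smooth_on M (Y i)) \<longrightarrow>
        (\<forall>p\<in>M. frechet_derivative (\<lambda>q. induced_vol F \<xi> q (\<lambda>i. Y i q)) (at p) (X p)
           = (\<Sum>j\<in>UNIV. induced_vol F \<xi> p ((\<lambda>i. Y i p)(j := induced_conn F \<xi> X (Y j) p)))))"

definition nondegenerate_form :: "('p::real_vector \<Rightarrow> 'p \<Rightarrow> real) \<Rightarrow> bool" where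
  "nondegenerate_form b \<longleftrightarrow> (\<forall>v. (\<forall>w. b v w = 0) \<longrightarrow> v = 0)"

definition positive_definite :: "('p::real_vector \<Rightarrow> 'p \<Rightarrow> real) \<Rightarrow> bool" where
  "positive_definite b \<longleftrightarrow> (\<forall>v. v \<noteq> 0 \<longrightarrow> b v v > 0)"

definition negative_definite :: "('p::real_vector \<Rightarrow> 'p \<Rightarrow> real) \<Rightarrow> bool" where
  "negative_definite b \<longleftrightarrow> (\<forall>v. v \<noteq> 0 \<longrightarrow> b v v < 0)"

text \<open>Definiteness of \<open>h\<close> does not depend on the transversal field used to compute it.\<close>

definition convex_hypersurface ::
    "'p::real_normed_vector set \<Rightarrow> ('p \<Rightarrow> 'v::real_normed_vector) \<Rightarrow> bool" where
  "convex_hypersurface M F \<longleftrightarrow> immersion_on M F \<and>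
     (\<exists>\<xi>. smooth_on M \<xi> \<and> transversal_on M F \<xi> \<and>
        (\<forall>p\<in>M. positive_definite (affine_metric F \<xi> p) \<or> negative_definite (affine_metric F \<xi> p)))"

definition affine_normal ::
    "'p::real_normed_vector set \<Rightarrow> ('p \<Rightarrow> (real ^ 'n::finite) \<times> real) \<Rightarrow> ('p \<Rightarrow> (real ^ 'n) \<times> real) \<Rightarrow> bool" where
  "affine_normal M F \<xi> \<longleftrightarrow>
     smooth_on M \<xi> \<and> transversal_on M F \<xi> \<and>
     (\<forall>p\<in>M. nondegenerate_form (affine_metric F \<xi> p)) \<and>
     equiaffine_on M F \<xi> \<and>
     (\<forall>p\<in>M. \<forall>V :: 'n \<Rightarrow> 'p. inj V \<and> independent (range V) \<longrightarrow>
        (induced_vol F \<xi> p V)\<^sup>2 = \<bar>det (\<chi> i j. affine_metric F \<xi> p (V i) (V j))\<bar>)"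

text \<open>The affine normal of a convex hypersurface, with its sign chosen.\<close>

definition convex_affine_normal ::
    "'p::real_normed_vector set \<Rightarrow> ('p \<Rightarrow> (real ^ 'n::finite) \<times> real) \<Rightarrow> ('p \<Rightarrow> (real ^ 'n) \<times> real) \<Rightarrow> bool" where
  "convex_affine_normal M F \<xi> \<longleftrightarrow>
     affine_normal M F \<xi> \<and> (\<forall>p\<in>M. positive_definite (affine_metric F \<xi> p))"

subsection \<open>The difference tensor and pointwise symmetry\<close>

text \<open>That \<open>\<nabla>\<^sub>X Y\<close> is again smooth need not be required: the Koszul formula, which follows from the
  last two conditions, determines \<open>\<nabla>\<^sub>X Y\<close> on \<open>M\<close> for smooth \<open>X\<close> and \<open>Y\<close>.\<close>

definition is_levi_civita ::
    "'p::real_normed_vector set \<Rightarrow> ('p \<Rightarrow> 'p \<Rightarrow> 'p \<Rightarrow> real) \<Rightarrow> (('p \<Rightarrow> 'p) \<Rightarrow> ('p \<Rightarrow> 'p) \<Rightarrow> 'p \<Rightarrow> 'p) \<Rightarrow> bool" where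
  "is_levi_civita M g nab \<longleftrightarrow>
     (\<forall>X Y Z f. smooth_on M X \<longrightarrow> smooth_on M Y \<longrightarrow> smooth_on M Z \<longrightarrow> smooth_on M (f :: 'p \<Rightarrow> real) \<longrightarrow>
       (\<forall>p\<in>M.
          nab (\<lambda>q. X q + Y q) Z p = nab X Z p + nab Y Z p \<and>
          nab (\<lambda>q. f q *\<^sub>R X q) Z p = f p *\<^sub>R nab X Z p \<and>
          nab X (\<lambda>q. Y q + Z q) p = nab X Y p + nab X Z p \<and>
          nab X (\<lambda>q. f q *\<^sub>R Y q) p = frechet_derivative f (at p) (X p) *\<^sub>R Y p + f p *\<^sub>R nab X Y p \<and>
          nab X Y p - nab Y X p = frechet_derivative Y (at p) (X p) - frechet_derivative X (at p) (Y p) \<and>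
          frechet_derivative (\<lambda>q. g q (Y q) (Z q)) (at p) (X p) = g p (nab X Y p) (Z p) + g p (Y p) (nab X Z p)))"

definition levi_civita ::
    "'p::real_normed_vector set \<Rightarrow> ('p \<Rightarrow> 'p \<Rightarrow> 'p \<Rightarrow> real) \<Rightarrow> ('p \<Rightarrow> 'p) \<Rightarrow> ('p \<Rightarrow> 'p) \<Rightarrow> 'p \<Rightarrow> 'p" where
  "levi_civita M g = (SOME nab. is_levi_civita M g nab)"

text \<open>As for \<open>h\<close>, the value at two tangent vectors is computed with constant extensions.\<close>

definition difference_tensor ::
    "'p::real_normed_vector set \<Rightarrow> ('p \<Rightarrow> 'v::real_normed_vector) \<Rightarrow> ('p \<Rightarrow> 'v) \<Rightarrow> 'p \<Rightarrow> 'p \<Rightarrow> 'p \<Rightarrow> 'p" where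
  "difference_tensor M F \<xi> p v w =
     induced_conn F \<xi> (\<lambda>_. v) (\<lambda>_. w) p - levi_civita M (affine_metric F \<xi>) (\<lambda>_. v) (\<lambda>_. w) p"

text \<open>\<open>g\<close> maps the \<open>b\<close>-orthogonal complement of \<open>x\<close> to itself, and its restriction is represented by
  a rotation matrix in some \<open>b\<close>-orthonormal basis of that complement. The parameter space is fixed to
  \<open>real \<times> (real ^ 'm)\<close> so that \<open>'m\<close> indexes the bases of the complement.\<close>

definition restricts_to_SO ::
    "(real \<times> (real ^ 'm) \<Rightarrow> real \<times> (real ^ 'm) \<Rightarrow> real) \<Rightarrow> real \<times> (real ^ 'm::finite) \<Rightarrow>
     (real \<times> (real ^ 'm) \<Rightarrow> real \<times> (real ^ 'm)) \<Rightarrow> bool" where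
  "restricts_to_SO b x g \<longleftrightarrow>
     (\<exists>(e :: 'm \<Rightarrow> real \<times> (real ^ 'm)) (A :: real ^ 'm ^ 'm).
        (\<forall>i. b x (e i) = 0) \<and> (\<forall>i j. b (e i) (e j) = (if i = j then 1 else 0)) \<and>
        rotation_matrix A \<and> (\<forall>j. g (e j) = (\<Sum>i\<in>UNIV. A $ i $ j *\<^sub>R e i)))"

definition pointwise_SO_symmetric ::
    "(real \<times> (real ^ 'm::finite)) set \<Rightarrow> (real \<times> (real ^ 'm) \<Rightarrow> 'v::real_normed_vector) \<Rightarrow>
     (real \<times> (real ^ 'm) \<Rightarrow> 'v) \<Rightarrow> bool" where
  "pointwise_SO_symmetric M F \<xi> \<longleftrightarrow>
     (\<forall>p\<in>M. \<exists>x. affine_metric F \<xi> p x x = 1 \<and>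
        (\<forall>g. linear g \<and> bij g \<and> g x = x \<and> restricts_to_SO (affine_metric F \<xi> p) x g \<longrightarrow>
           (\<forall>v w. shape_op F \<xi> p (g v) = g (shape_op F \<xi> p v) \<and>
              difference_tensor M F \<xi> p (g v) (g w) = g (difference_tensor M F \<xi> p v w))))"

subsection \<open>Centred quadrics\<close>

text \<open>The coordinate \<open>k\<close> plays the role of the last one; the other sheet and other choices of \<open>k\<close> are
  obtained by linear maps of determinant 1.\<close>

definition eps_quadric :: "real \<Rightarrow> (real ^ 'm::finite) set \<Rightarrow> (real ^ 'm \<Rightarrow> real ^ 'n::finite) \<Rightarrow> bool" where
  "eps_quadric \<epsilon> U \<phi> \<longleftrightarrow> immersion_on U \<phi> \<and>
     (\<exists>A :: real ^ 'n ^ 'n. det A = 1 \<and>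
        (\<epsilon> = 1 \<and> \<phi> ` U \<subseteq> (*v) A ` {x. (\<Sum>i\<in>UNIV. (x $ i)\<^sup>2) = 1} \<or>
         \<epsilon> = -1 \<and> (\<exists>k. \<phi> ` U \<subseteq> (*v) A ` {x. (\<Sum>i\<in>-{k}. (x $ i)\<^sup>2) - (x $ k)\<^sup>2 = -1 \<and> x $ k > 0})))"

end

theory Submission
  imports Defs
begin

text \<open>
  Let \<open>Q\<close> be the quadratic form with \<open>Q(\<phi>, \<phi>) = \<epsilon>\<close>. Differentiating this equation gives
  \<open>D\<^sup>2\<phi>(v, w) = D\<phi>(\<Gamma>(v, w)) - \<epsilon> g(v, w) \<phi>\<close>, where \<open>g\<close> is the restriction of \<open>Q\<close> to the tangent spaces,
  positive definite in both cases, and \<open>\<Gamma>\<close> is its Levi-Civita connection. Substituting this in the second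
  derivative of \<open>F\<close> yields \<open>h = \<alpha> dt\<^sup>2 + \<beta> g\<close> with \<open>\<alpha> = W / (\<gamma>\<^sub>2' \<mu>)\<close>, \<open>\<beta> = - \<epsilon> \<gamma>\<^sub>1 / \<mu>\<close> and
  \<open>W = \<gamma>\<^sub>1'' \<gamma>\<^sub>2' - \<gamma>\<^sub>2'' \<gamma>\<^sub>1'\<close>, which is positive definite once \<open>\<mu>\<close> has the sign of \<open>\<gamma>\<^sub>2' W\<close>. The equation
  for the derivative of \<open>\<mu>\<close> says that \<open>\<tau> = 0\<close>, and the other one is the volume condition. Both the Blaschke
  connection and the connection of the warped product \<open>h\<close> contain \<open>\<Gamma>\<close>, so it cancels in \<open>K\<close>, which is
  of the form \<open>K((a, v), (b, w)) = (c\<^sub>1 a b + c\<^sub>2 g(v, w), c\<^sub>3 (a w + b v))\<close>. This, and the shape operator,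
  commute with all isometries fixing \<open>\<partial>\<^sub>t\<close>.
\<close>

section \<open>Calculus of smooth maps\<close>

text \<open>No differential equation is solved: the volume equation is algebraic in \<mu>, so \<mu>
  is an explicit root, and \<nu> is read off from its derivative. The exponents come from
  \<open>\<alpha> \<beta>^(n-1) = \<mu>^2 (\<gamma>\<^sub>2')^2 \<gamma>\<^sub>1^(2(n-1))\<close>,
  which compares the determinant of h with the squared volume; inserting \<alpha> and \<beta>
  leaves, up to sign, n + 2 on \<mu>, n - 1 on \<open>\<gamma>\<^sub>1\<close> and 3 on
  \<open>\<gamma>\<^sub>2'\<close>. The hypothesis on the curve says that \<alpha> and \<beta> have
  the same sign. Three obstacles shape the development. \<open>smooth_on\<close> speaks of
  derivatives in fixed directions, so moving vectors are expanded in a basis. The Levi-Civita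
  connection is a chosen one, so an explicit connection must satisfy the complete definition and
  then agree with the chosen one on constant fields. The coordinates of \<phi> are unknown while
  products under \<open>Q\<close> are known, so the volume is found from a Gram determinant; this
  loses its sign, which the squared volume condition does not see.\<close>

lemma Ck_on_cong:
  assumes "open M" and "\<And>p. p \<in> M \<Longrightarrow> f p = g p"
  shows "Ck_on k M f = Ck_on k M g"
  using assms(2)
proof (induction k arbitrary: f g)
  case 0
  then show ?case
    by (auto intro: continuous_on_cong)
next
  case (Suc k)
  have diff: "f differentiable (at p) \<longleftrightarrow> g differentiable (at p)" if "p \<in> M" for p
    using has_derivative_transform_within_open[OF _ assms(1) that] Suc.prems
    unfolding differentiable_def by metis
  have fd: "frechet_derivative f (at p) = frechet_derivative g (at p)" if "p \<in> M" for p
    \<comment> \<open>\<open>frechet_derivative\<close> is a choice among all derivatives, so the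
      two values agree once the two defining predicates agree.\<close>
    unfolding frechet_derivative_def
    by (rule arg_cong[of _ _ Eps], rule ext)
      (metis has_derivative_transform_within_open[OF _ assms(1) that] Suc.prems)
  have "Ck_on k M (\<lambda>p. frechet_derivative f (at p) v) = Ck_on k M (\<lambda>p. frechet_derivative g (at p) v)" for v
    by (rule Suc.IH) (simp add: fd)
  then show ?case
    using diff by auto
qed

lemma smooth_on_cong:
  assumes "open M" and "\<And>p. p \<in> M \<Longrightarrow> f p = g p"
  shows "smooth_on M f = smooth_on M g"
  unfolding smooth_on_def using Ck_on_cong[where f = f and g = g, OF assms] by simp

lemma Ck_on_Suc_imp: "Ck_on (Suc k) M f \<Longrightarrow> Ck_on k M f"
proof (induction k arbitrary: f)
  case 0
  then show ?case
    by (auto intro!: continuous_at_imp_continuous_on differentiable_imp_continuous_within)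
next
  case (Suc k)
  from Suc.prems have "f differentiable (at p)" if "p \<in> M" for p
    using that by simp
  moreover have "Ck_on k M (\<lambda>p. frechet_derivative f (at p) v)" for v
    using Suc.prems by (intro Suc.IH) (simp only: Ck_on.simps(2)[of "Suc k"])
  ultimately show ?case
    by simp
qed

lemma smooth_onD_differentiable: "smooth_on M f \<Longrightarrow> p \<in> M \<Longrightarrow> f differentiable (at p)"
  unfolding smooth_on_def using Ck_on.simps(2) by blast

lemma smooth_onD_has_derivative:
  "smooth_on M f \<Longrightarrow> p \<in> M \<Longrightarrow> (f has_derivative frechet_derivative f (at p)) (at p)"
  using smooth_onD_differentiable frechet_derivative_works by blast

lemma smooth_on_frechet_derivative:
  "smooth_on M f \<Longrightarrow> smooth_on M (\<lambda>p. frechet_derivative f (at p) v)"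
  unfolding smooth_on_def using Ck_on.simps(2) by blast

lemma smooth_on_continuous_on: "smooth_on M f \<Longrightarrow> continuous_on M f"
  unfolding smooth_on_def using Ck_on.simps(1) by blast

text \<open>Any explicit formula for the derivative may stand in for
  \<open>frechet_derivative\<close>; the closure properties below then reduce to product and chain
  rules.\<close>

lemma Ck_on_SucI:
  assumes "open M" and "\<And>p. p \<in> M \<Longrightarrow> (f has_derivative D p) (at p)"
    and "\<And>v. Ck_on k M (\<lambda>p. D p v)"
  shows "Ck_on (Suc k) M f"
proof -
  have "frechet_derivative f (at p) = D p" if "p \<in> M" for p
    using frechet_derivative_at[OF assms(2)[OF that]] by simp
  then have "Ck_on k M (\<lambda>p. frechet_derivative f (at p) v)" for v
    using assms(3)[of v] Ck_on_cong[OF assms(1), of "\<lambda>p. frechet_derivative f (at p) v" "\<lambda>p. D p v"] by simp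
  then show ?thesis
    using assms(2) by (auto simp: differentiable_def)
qed

lemma Ck_on_SucD:
  assumes "Ck_on (Suc k) M f"
  shows "\<And>p. p \<in> M \<Longrightarrow> (f has_derivative frechet_derivative f (at p)) (at p)"
    and "\<And>v. Ck_on k M (\<lambda>p. frechet_derivative f (at p) v)"
  using assms by (auto simp: frechet_derivative_works)

lemma Ck_on_const: "Ck_on k M (\<lambda>_. c)"
  by (induction k arbitrary: c) auto

lemma smooth_on_const [simp]: "smooth_on M (\<lambda>_. c)"
  by (simp add: smooth_on_def Ck_on_const)

lemma Ck_on_add:
  assumes "open M" "Ck_on k M f" "Ck_on k M g"
  shows "Ck_on k M (\<lambda>p. f p + g p)"
  using assms(2,3)
proof (induction k arbitrary: f g)
  case 0
  then show ?case by (auto intro: continuous_intros)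
next
  case (Suc k)
  show ?case
    by (rule Ck_on_SucI[OF assms(1) has_derivative_add[OF Ck_on_SucD(1)[OF Suc.prems(1)] Ck_on_SucD(1)[OF Suc.prems(2)]]])
      (auto intro: Suc.IH Ck_on_SucD[OF Suc.prems(1)] Ck_on_SucD[OF Suc.prems(2)])
qed

text \<open>The derivative is a sum of two terms of the same bilinear shape, so the induction closes
  once the order of the underived factor is lowered. Products and scalar multiples of functions are
  instances.\<close>

lemma Ck_on_bilinear:
  assumes "bounded_bilinear b" "open M" "Ck_on k M f" "Ck_on k M g"
  shows "Ck_on k M (\<lambda>p. b (f p) (g p))"
  using assms(3,4)
proof (induction k arbitrary: f g)
  case 0
  then show ?case
    by (simp add: bounded_bilinear.continuous_on[OF assms(1)])
next
  case (Suc k)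
  show ?case
    by (rule Ck_on_SucI[OF assms(2) bounded_bilinear.FDERIV[OF assms(1) Ck_on_SucD(1)[OF Suc.prems(1)] Ck_on_SucD(1)[OF Suc.prems(2)]]])
      (auto intro!: Ck_on_add[OF assms(2)] Suc.IH Ck_on_SucD(2)[OF Suc.prems(1)] Ck_on_SucD(2)[OF Suc.prems(2)]
         Ck_on_Suc_imp[OF Suc.prems(1)] Ck_on_Suc_imp[OF Suc.prems(2)])
qed

text \<open>The inner maps to be covered are the projections of \<open>I \<times> U\<close>. For a
  linear inner map the derivative in a fixed direction is again a composite of the same
  shape.\<close>

lemma Ck_on_compose_linear:
  assumes "bounded_linear L" "open M" "L ` M \<subseteq> N" "Ck_on k N f"
  shows "Ck_on k M (\<lambda>p. f (L p))"
  using assms(4)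
proof (induction k arbitrary: f)
  case 0
  then show ?case
    using continuous_on_compose2[OF _ linear_continuous_on[OF assms(1)] assms(3)] by auto
next
  case (Suc k)
  have "((\<lambda>p. f (L p)) has_derivative (\<lambda>v. frechet_derivative f (at (L p)) (L v))) (at p)" if "p \<in> M" for p
    using diff_chain_at[OF bounded_linear_imp_has_derivative[OF assms(1)] Ck_on_SucD(1)[OF Suc.prems]]
      that assms(3) by (auto simp: o_def)
  then show ?case
    by (rule Ck_on_SucI[OF assms(2)]) (auto intro!: Suc.IH Ck_on_SucD(2)[OF Suc.prems])
qed

lemma Ck_on_linear_compose:
  assumes "bounded_linear L" "open M" "Ck_on k M f"
  shows "Ck_on k M (\<lambda>p. L (f p))"
  using assms(3)
proof (induction k arbitrary: f)
  case 0
  then show ?case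
    by (simp add: bounded_linear.continuous_on[OF assms(1)])
next
  case (Suc k)
  show ?case
    by (rule Ck_on_SucI[OF assms(2) bounded_linear.has_derivative[OF assms(1) Ck_on_SucD(1)[OF Suc.prems]]])
      (auto intro!: Suc.IH Ck_on_SucD(2)[OF Suc.prems])
qed

text \<open>The exponent is generalised because differentiation lowers it by one. Reciprocals and
  the root defining \<mu> are both obtained from this.\<close>

lemma Ck_on_powr:
  fixes f :: "'p::real_normed_vector \<Rightarrow> real"
  assumes "open M" "\<And>p. p \<in> M \<Longrightarrow> f p > 0" "Ck_on k M f"
  shows "Ck_on k M (\<lambda>p. f p powr c)"
  using assms(3)
proof (induction k arbitrary: c)
  case 0
  then show ?case
    using assms(2) by (auto intro!: continuous_intros) (metis less_irrefl)
next
  case (Suc k)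
  have "((\<lambda>p. f p powr c) has_derivative (\<lambda>v. (c * f p powr (c - 1)) * frechet_derivative f (at p) v)) (at p)"
    if "p \<in> M" for p
  proof -
    have "((\<lambda>p. f p powr c) has_derivative
        (\<lambda>v. frechet_derivative f (at p) v * (c * f p powr (c - 1)))) (at p)"
      using DERIV_compose_FDERIV[OF has_real_derivative_powr[OF assms(2)[OF that]] Ck_on_SucD(1)[OF Suc.prems that]]
      by simp
    then show ?thesis by (simp add: mult.commute)
  qed
  then show ?case
    by (rule Ck_on_SucI[OF assms(1)])
      (auto intro!: Ck_on_bilinear[OF bounded_bilinear_mult assms(1)] Ck_on_const
         Suc.IH Ck_on_SucD(2)[OF Suc.prems] Ck_on_Suc_imp[OF Suc.prems])
qed

lemma smooth_on_add:
  "open M \<Longrightarrow> smooth_on M f \<Longrightarrow> smooth_on M g \<Longrightarrow> smooth_on M (\<lambda>p. f p + g p)"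
  by (simp add: smooth_on_def Ck_on_add)

lemma smooth_on_bilinear:
  "bounded_bilinear b \<Longrightarrow> open M \<Longrightarrow> smooth_on M f \<Longrightarrow> smooth_on M g \<Longrightarrow> smooth_on M (\<lambda>p. b (f p) (g p))"
  by (simp add: smooth_on_def Ck_on_bilinear)

lemma smooth_on_linear_compose:
  "bounded_linear L \<Longrightarrow> open M \<Longrightarrow> smooth_on M f \<Longrightarrow> smooth_on M (\<lambda>p. L (f p))"
  by (simp add: smooth_on_def Ck_on_linear_compose)

lemma smooth_on_compose_linear:
  "bounded_linear L \<Longrightarrow> open M \<Longrightarrow> L ` M \<subseteq> N \<Longrightarrow> smooth_on N f \<Longrightarrow> smooth_on M (\<lambda>p. f (L p))"
  by (simp add: smooth_on_def Ck_on_compose_linear)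

lemma smooth_on_powr:
  fixes f :: "'p::real_normed_vector \<Rightarrow> real"
  shows "open M \<Longrightarrow> (\<And>p. p \<in> M \<Longrightarrow> f p > 0) \<Longrightarrow> smooth_on M f \<Longrightarrow> smooth_on M (\<lambda>p. f p powr c)"
  by (simp add: smooth_on_def Ck_on_powr)

lemmas smooth_on_scaleR = smooth_on_bilinear[OF bounded_bilinear_scaleR]
lemmas smooth_on_mult = smooth_on_bilinear[OF bounded_bilinear_mult]

lemma smooth_on_uminus: "open M \<Longrightarrow> smooth_on M f \<Longrightarrow> smooth_on M (\<lambda>p. - f p)"
  by (rule smooth_on_linear_compose[OF bounded_linear_minus[OF bounded_linear_ident]])

lemma smooth_on_diff:
  "open M \<Longrightarrow> smooth_on M f \<Longrightarrow> smooth_on M g \<Longrightarrow> smooth_on M (\<lambda>p. f p - g p)"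
  using smooth_on_add[OF _ _ smooth_on_uminus] by fastforce

lemma smooth_on_power:
  fixes f :: "'p::real_normed_vector \<Rightarrow> real"
  shows "open M \<Longrightarrow> smooth_on M f \<Longrightarrow> smooth_on M (\<lambda>p. f p ^ k)"
  by (induction k) (auto intro: smooth_on_mult)

lemma smooth_on_inverse:
  fixes f :: "'p::real_normed_vector \<Rightarrow> real"
  assumes "open M" "smooth_on M f" "\<And>p. p \<in> M \<Longrightarrow> f p \<noteq> 0"
  shows "smooth_on M (\<lambda>p. inverse (f p))"
proof -
  \<comment> \<open>\<open>powr\<close> is treated for a positive base, hence the reciprocal is
    taken of the square.\<close>
  have "smooth_on M (\<lambda>p. f p * (f p ^ 2) powr (-1))"
    by (intro smooth_on_mult smooth_on_powr smooth_on_power) (use assms in auto)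
  moreover have "f p * (f p ^ 2) powr (-1) = inverse (f p)" if "p \<in> M" for p
    using assms(3)[OF that] by (simp add: powr_minus powr_one' power2_eq_square field_simps)
  ultimately show ?thesis
    using smooth_on_cong[OF assms(1), of "\<lambda>p. f p * (f p ^ 2) powr (-1)" "\<lambda>p. inverse (f p)"] by simp
qed

lemma smooth_on_divide:
  fixes f g :: "'p::real_normed_vector \<Rightarrow> real"
  assumes "open M" "smooth_on M f" "smooth_on M g" "\<And>p. p \<in> M \<Longrightarrow> g p \<noteq> 0"
  shows "smooth_on M (\<lambda>p. f p / g p)"
  unfolding divide_inverse by (intro smooth_on_mult smooth_on_inverse assms)

lemma smooth_on_Pair:
  assumes "open M" "smooth_on M f" "smooth_on M g"
  shows "smooth_on M (\<lambda>p. (f p, g p))"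
proof -
  have "smooth_on M (\<lambda>p. (f p, 0) + (0, g p))"
    by (intro smooth_on_add assms smooth_on_linear_compose[OF _ assms(1,2), of "\<lambda>x. (x, 0)"]
        smooth_on_linear_compose[OF _ assms(1,3), of "\<lambda>x. (0, x)"])
      (auto intro!: bounded_linear_Pair bounded_linear_ident bounded_linear_zero)
  then show ?thesis by simp
qed

lemma smooth_on_DERIV:
  fixes f :: "real \<Rightarrow> real"
  assumes "smooth_on I f" "t \<in> I"
  shows "(f has_real_derivative deriv f t) (at t)"
  using smooth_onD_differentiable[OF assms] DERIV_deriv_iff_real_differentiable by blast

lemma smooth_on_deriv:
  fixes f :: "real \<Rightarrow> real"
  assumes "open I" "smooth_on I f"
  shows "smooth_on I (deriv f)"
proof -
  have "frechet_derivative f (at t) 1 = deriv f t" if "t \<in> I" for t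
    using frechet_derivative_at[OF smooth_on_DERIV[OF assms(2) that, unfolded has_field_derivative_def]]
    by (metis mult_1_right)
  then show ?thesis
    using smooth_on_frechet_derivative[OF assms(2), of 1]
      smooth_on_cong[OF assms(1), of "\<lambda>t. frechet_derivative f (at t) 1" "deriv f"] by simp
qed

section \<open>Second derivatives and their symmetry\<close>

text \<open>The first slot is the direction of the outer derivative. Linearity there is that of a
  derivative; linearity in the second slot has to be proved.\<close>

definition hess :: "('p::real_normed_vector \<Rightarrow> 'v::real_normed_vector) \<Rightarrow> 'p \<Rightarrow> 'p \<Rightarrow> 'p \<Rightarrow> 'v" where
  "hess f p v w = frechet_derivative (\<lambda>q. frechet_derivative f (at q) w) (at p) v"

lemma hess_has_derivative:
  "smooth_on M f \<Longrightarrow> p \<in> M \<Longrightarrow>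
    ((\<lambda>q. frechet_derivative f (at q) w) has_derivative (\<lambda>v. hess f p v w)) (at p)"
  unfolding hess_def by (rule smooth_onD_has_derivative[OF smooth_on_frechet_derivative])

lemma continuous_on_hess: "smooth_on M f \<Longrightarrow> continuous_on M (\<lambda>p. hess f p v w)"
  unfolding hess_def by (intro smooth_on_continuous_on smooth_on_frechet_derivative)

lemma linear_frechet: "smooth_on M f \<Longrightarrow> p \<in> M \<Longrightarrow> linear (frechet_derivative f (at p))"
  by (rule linear_frechet_derivative[OF smooth_onD_differentiable])

lemma frechet_derivative_expand:
  fixes f :: "'p::euclidean_space \<Rightarrow> 'v::real_normed_vector"
  assumes "smooth_on M f" "p \<in> M"
  shows "frechet_derivative f (at p) w = (\<Sum>b\<in>Basis. (w \<bullet> b) *\<^sub>R frechet_derivative f (at p) b)"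
proof -
  interpret linear "frechet_derivative f (at p)"
    by (rule linear_frechet[OF assms])
  have "frechet_derivative f (at p) (\<Sum>b\<in>Basis. (w \<bullet> b) *\<^sub>R b)
      = (\<Sum>b\<in>Basis. (w \<bullet> b) *\<^sub>R frechet_derivative f (at p) b)"
    by (simp only: sum scaleR)
  then show ?thesis
    by (simp only: euclidean_representation)
qed

text \<open>\<open>Ck_on\<close> differentiates the first derivative for one fixed direction
  \<open>w\<close> at a time. Dependence on \<open>w\<close> is inherited from the basis expansion
  of the first derivative, valid at all points of the open set.\<close>

lemma hess_expand:
  fixes f :: "'p::euclidean_space \<Rightarrow> 'v::real_normed_vector"
  assumes "open M" "smooth_on M f" "p \<in> M"
  shows "hess f p v w = (\<Sum>b\<in>Basis. (w \<bullet> b) *\<^sub>R hess f p v b)"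
proof -
  have "((\<lambda>q. \<Sum>b\<in>Basis. (w \<bullet> b) *\<^sub>R frechet_derivative f (at q) b) has_derivative
      (\<lambda>v. \<Sum>b\<in>Basis. (w \<bullet> b) *\<^sub>R hess f p v b)) (at p)"
    by (intro has_derivative_sum has_derivative_scaleR_right hess_has_derivative[OF assms(2,3)])
  then have "((\<lambda>q. frechet_derivative f (at q) w) has_derivative
      (\<lambda>v. \<Sum>b\<in>Basis. (w \<bullet> b) *\<^sub>R hess f p v b)) (at p)"
    by (rule has_derivative_transform_within_open[OF _ assms(1,3)])
      (rule frechet_derivative_expand[OF assms(2), symmetric])
  from has_derivative_unique[OF this hess_has_derivative[OF assms(2,3)]]
  show ?thesis by metis
qed

lemma linear_hess_right:
  fixes f :: "'p::euclidean_space \<Rightarrow> 'v::real_normed_vector"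
  assumes "open M" "smooth_on M f" "p \<in> M"
  shows "linear (hess f p v)"
proof -
  have "linear (\<lambda>w. \<Sum>b\<in>Basis. (w \<bullet> b) *\<^sub>R hess f p v b)"
    by (intro linear_compose_sum ballI linearI) (simp_all add: inner_add_left scaleR_add_left)
  moreover have "hess f p v = (\<lambda>w. \<Sum>b\<in>Basis. (w \<bullet> b) *\<^sub>R hess f p v b)"
    using hess_expand[OF assms] by blast
  ultimately show ?thesis by simp
qed

text \<open>A derivative is taken at a moving point \<open>c q\<close> in a moving direction
  \<open>Y q\<close>. In basis coordinates the directions become constant and each summand is an
  ordinary product. With \<open>c\<close> the identity this computes \<open>D\<^sub>X Y\<close>;
  with \<open>c\<close> a projection it differentiates the quadric metric along the product.\<close>

lemma frechet_derivative_along_has_derivative: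
  fixes f :: "'p::euclidean_space \<Rightarrow> 'v::real_normed_vector"
  assumes "open M" "smooth_on M f" "c p \<in> M"
    and "(c has_derivative dc) (at p)" "(Y has_derivative dY) (at p)"
  shows "((\<lambda>q. frechet_derivative f (at (c q)) (Y q)) has_derivative
     (\<lambda>v. frechet_derivative f (at (c p)) (dY v) + hess f (c p) (dc v) (Y p))) (at p)"
proof -
  note expand = frechet_derivative_expand[OF assms(2)]
  have comp: "((\<lambda>q. frechet_derivative f (at (c q)) b) has_derivative (\<lambda>v. hess f (c p) (dc v) b)) (at p)" for b
    using diff_chain_at[OF assms(4) hess_has_derivative[OF assms(2,3)]] by (simp add: o_def)
  have "((\<lambda>q. \<Sum>b\<in>Basis. (Y q \<bullet> b) *\<^sub>R frechet_derivative f (at (c q)) b) has_derivative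
     (\<lambda>v. \<Sum>b\<in>Basis. (Y p \<bullet> b) *\<^sub>R hess f (c p) (dc v) b + (dY v \<bullet> b) *\<^sub>R frechet_derivative f (at (c p)) b)) (at p)"
    by (intro has_derivative_sum has_derivative_scaleR has_derivative_inner_left comp assms(5))
  moreover have "(\<lambda>v. \<Sum>b\<in>Basis. (Y p \<bullet> b) *\<^sub>R hess f (c p) (dc v) b + (dY v \<bullet> b) *\<^sub>R frechet_derivative f (at (c p)) b)
      = (\<lambda>v. frechet_derivative f (at (c p)) (dY v) + hess f (c p) (dc v) (Y p))"
    by (simp add: sum.distrib expand[OF assms(3), symmetric] hess_expand[OF assms(1-3), symmetric] add.commute)
  ultimately have D: "((\<lambda>q. \<Sum>b\<in>Basis. (Y q \<bullet> b) *\<^sub>R frechet_derivative f (at (c q)) b) has_derivative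
     (\<lambda>v. frechet_derivative f (at (c p)) (dY v) + hess f (c p) (dc v) (Y p))) (at p)"
    by simp
  \<comment> \<open>The expansion is available where \<open>c q\<close> lies in \<open>M\<close>,
    which continuity of \<open>c\<close> and openness of \<open>M\<close> ensure near
    \<open>p\<close>.\<close>
  have "eventually (\<lambda>q. c q \<in> M) (at p)"
    using has_derivative_continuous[OF assms(4)] assms(1,3)
    by (simp add: continuous_at tendsto_def)
  then have "eventually (\<lambda>q. (\<Sum>b\<in>Basis. (Y q \<bullet> b) *\<^sub>R frechet_derivative f (at (c q)) b)
      = frechet_derivative f (at (c q)) (Y q)) (at p)"
    by eventually_elim (rule expand[symmetric])
  from has_derivative_transform_eventually[OF D this expand[OF assms(3), symmetric]]
  show ?thesis by simp
qed

text \<open>The mean value theorem is applied in direction \<open>v\<close> to the difference of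
  \<open>f\<close> along two parallel segments, and then in direction \<open>w\<close> to the
  derivative so obtained.\<close>

lemma second_difference_mvt:
  fixes f :: "'p::real_normed_vector \<Rightarrow> real"
  assumes "smooth_on M f" "0 < s"
    and sub: "\<And>a b. 0 \<le> a \<Longrightarrow> a \<le> s \<Longrightarrow> 0 \<le> b \<Longrightarrow> b \<le> s \<Longrightarrow> p + a *\<^sub>R v + b *\<^sub>R w \<in> M"
  shows "\<exists>a b. 0 < a \<and> a < s \<and> 0 < b \<and> b < s \<and>
     f (p + s *\<^sub>R v + s *\<^sub>R w) - f (p + s *\<^sub>R v) - f (p + s *\<^sub>R w) + f p
       = s * s * hess f (p + a *\<^sub>R v + b *\<^sub>R w) w v"
proof -
  let ?D = "frechet_derivative f"
  have along: "((\<lambda>a. G (q + a *\<^sub>R v)) has_real_derivative G' v) (at a)"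
    if "(G has_derivative G') (at (q + a *\<^sub>R v))" for G :: "'p \<Rightarrow> real" and G' q v a
  proof -
    have "((\<lambda>a. q + a *\<^sub>R v) has_derivative (\<lambda>h. h *\<^sub>R v)) (at a)"
      by (auto intro!: derivative_eq_intros)
    from diff_chain_at[OF this that] show ?thesis
      using linear_cmul[OF has_derivative_linear[OF that]]
      by (simp add: o_def has_field_derivative_def mult_commute_abs)
  qed
  let ?g = "\<lambda>a. f ((p + s *\<^sub>R w) + a *\<^sub>R v) - f (p + a *\<^sub>R v)"
  have "\<exists>a>0. a < s \<and> ?g s - ?g 0
      = (s - 0) * (?D (at ((p + s *\<^sub>R w) + a *\<^sub>R v)) v - ?D (at (p + a *\<^sub>R v)) v)"
  proof (rule MVT2[OF assms(2)])
    fix a assume "0 \<le> a" "a \<le> s"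
    then have "(p + s *\<^sub>R w) + a *\<^sub>R v \<in> M" "p + a *\<^sub>R v \<in> M"
      using sub[of a s] sub[of a 0] assms(2) by (simp_all add: algebra_simps)
    then show "(?g has_real_derivative ?D (at ((p + s *\<^sub>R w) + a *\<^sub>R v)) v - ?D (at (p + a *\<^sub>R v)) v) (at a)"
      by (intro DERIV_diff along smooth_onD_has_derivative[OF assms(1)])
  qed
  then obtain a where a: "0 < a" "a < s"
    "?g s - ?g 0 = s * (?D (at ((p + a *\<^sub>R v) + s *\<^sub>R w)) v - ?D (at (p + a *\<^sub>R v)) v)"
    by (auto simp: algebra_simps)
  let ?k = "\<lambda>b. ?D (at ((p + a *\<^sub>R v) + b *\<^sub>R w)) v"
  have "\<exists>b>0. b < s \<and> ?k s - ?k 0 = (s - 0) * hess f (p + a *\<^sub>R v + b *\<^sub>R w) w v"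
  proof (rule MVT2[OF assms(2)])
    fix b assume "0 \<le> b" "b \<le> s"
    then have "p + a *\<^sub>R v + b *\<^sub>R w \<in> M"
      using sub[of a b] a by simp
    from along[OF hess_has_derivative[OF assms(1) this, of v]]
    show "(?k has_real_derivative hess f (p + a *\<^sub>R v + b *\<^sub>R w) w v) (at b)" .
  qed
  then obtain b where b: "0 < b" "b < s" "?k s - ?k 0 = s * hess f (p + a *\<^sub>R v + b *\<^sub>R w) w v"
    by auto
  have "f (p + s *\<^sub>R v + s *\<^sub>R w) - f (p + s *\<^sub>R v) - f (p + s *\<^sub>R w) + f p = ?g s - ?g 0"
    by (simp add: algebra_simps)
  also have "\<dots> = s * s * hess f (p + a *\<^sub>R v + b *\<^sub>R w) w v"
    unfolding a(3) using b(3) by simp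
  finally show ?thesis
    using a(1,2) b(1,2) by blast
qed

text \<open>Schwarz: the second difference over a small parallelogram is symmetric in
  \<open>v\<close> and \<open>w\<close>, and equals \<open>s * s\<close> times either mixed
  derivative at some interior point; continuity at \<open>p\<close> does the rest.\<close>

lemma hess_symmetric_real:
  fixes f :: "'p::real_normed_vector \<Rightarrow> real"
  assumes "open M" "smooth_on M f" "p \<in> M"
  shows "hess f p v w = hess f p w v"
proof (rule ccontr)
  assume "hess f p v w \<noteq> hess f p w v"
  moreover define e where "e = \<bar>hess f p v w - hess f p w v\<bar> / 2"
  ultimately have e: "e > 0" "\<bar>hess f p v w - hess f p w v\<bar> = e + e" by simp_all
  obtain d1 where d1: "d1 > 0" "\<And>q. q \<in> M \<Longrightarrow> dist q p < d1 \<Longrightarrow> dist (hess f q v w) (hess f p v w) < e"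
    using continuous_on_hess[OF assms(2), of v w] assms(3) e(1) unfolding continuous_on_iff by blast
  obtain d2 where d2: "d2 > 0" "\<And>q. q \<in> M \<Longrightarrow> dist q p < d2 \<Longrightarrow> dist (hess f q w v) (hess f p w v) < e"
    using continuous_on_hess[OF assms(2), of w v] assms(3) e(1) unfolding continuous_on_iff by blast
  obtain d3 where d3: "d3 > 0" "ball p d3 \<subseteq> M"
    using assms(1,3) openE by blast
  \<comment> \<open>The tolerance \<open>e\<close> is half the supposed gap. The scale
    \<open>s\<close> keeps the parallelogram inside the ball of radius \<open>d\<close>, where both
    mixed derivatives stay within \<open>e\<close> of their values at \<open>p\<close>; the summand
    1 keeps \<open>N\<close> positive.\<close>
  define d where "d = min d1 (min d2 d3)"
  define N where "N = norm v + norm w + 1"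
  define s where "s = d / (2 * N)"
  have dpos: "d > 0" using d1(1) d2(1) d3(1) by (simp add: d_def)
  have npos: "N > 0" unfolding N_def by (smt (verit) norm_ge_zero)
  have spos: "s > 0" using dpos npos by (simp add: s_def)
  have near: "dist (p + a *\<^sub>R v + b *\<^sub>R w) p < d" if "0 \<le> a" "a \<le> s" "0 \<le> b" "b \<le> s" for a b
  proof -
    have "dist (p + a *\<^sub>R v + b *\<^sub>R w) p \<le> a * norm v + b * norm w"
      using norm_triangle_ineq[of "a *\<^sub>R v" "b *\<^sub>R w"] that by (simp add: dist_norm)
    also have "\<dots> \<le> s * norm v + s * norm w"
      using that by (intro add_mono mult_right_mono) auto
    also have "\<dots> \<le> s * N"
      using spos by (simp add: N_def algebra_simps)
    also have "\<dots> = d / 2"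
      using npos by (simp add: s_def)
    finally show ?thesis using dpos by simp
  qed
  have sub: "p + a *\<^sub>R v + b *\<^sub>R w \<in> M" if "0 \<le> a" "a \<le> s" "0 \<le> b" "b \<le> s" for a b
    using near[OF that] d3(2) by (auto simp: d_def dist_commute)
  have sub': "p + a *\<^sub>R w + b *\<^sub>R v \<in> M" if "0 \<le> a" "a \<le> s" "0 \<le> b" "b \<le> s" for a b
    using sub[OF that(3,4,1,2)] by (simp add: algebra_simps)
  obtain a b where ab: "0 < a" "a < s" "0 < b" "b < s"
    "f (p + s *\<^sub>R v + s *\<^sub>R w) - f (p + s *\<^sub>R v) - f (p + s *\<^sub>R w) + f p
       = s * s * hess f (p + a *\<^sub>R v + b *\<^sub>R w) w v"
    using second_difference_mvt[OF assms(2) spos sub] by blast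
  obtain a' b' where ab': "0 < a'" "a' < s" "0 < b'" "b' < s"
    "f (p + s *\<^sub>R w + s *\<^sub>R v) - f (p + s *\<^sub>R w) - f (p + s *\<^sub>R v) + f p
       = s * s * hess f (p + a' *\<^sub>R w + b' *\<^sub>R v) v w"
    using second_difference_mvt[OF assms(2) spos sub'] by blast
  have "s * s * hess f (p + a *\<^sub>R v + b *\<^sub>R w) w v = s * s * hess f (p + b' *\<^sub>R v + a' *\<^sub>R w) v w"
    using ab(5) ab'(5) by (simp add: algebra_simps)
  then have "hess f (p + a *\<^sub>R v + b *\<^sub>R w) w v = hess f (p + b' *\<^sub>R v + a' *\<^sub>R w) v w"
    using spos by simp
  moreover have "dist (hess f (p + a *\<^sub>R v + b *\<^sub>R w) w v) (hess f p w v) < e"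
    using ab near[of a b] by (intro d2(2) sub) (auto simp: d_def)
  moreover have "dist (hess f (p + b' *\<^sub>R v + a' *\<^sub>R w) v w) (hess f p v w) < e"
    using ab' near[of b' a'] by (intro d1(2) sub) (auto simp: d_def)
  ultimately show False
    using e(2) unfolding dist_real_def by linarith
qed

text \<open>The mean value theorem is about real functions, so components are treated one at a
  time.\<close>

lemma hess_symmetric:
  fixes f :: "'p::real_normed_vector \<Rightarrow> 'v::euclidean_space"
  assumes "open M" "smooth_on M f" "p \<in> M"
  shows "hess f p v w = hess f p w v"
proof (rule euclidean_eqI)
  fix b :: 'v
  have sm: "smooth_on M (\<lambda>q. f q \<bullet> b)"
    by (rule smooth_on_linear_compose[OF bounded_linear_inner_left assms(1,2)])
  have "hess (\<lambda>q. f q \<bullet> b) p x y = hess f p x y \<bullet> b" for x y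
  proof -
    have *: "((\<lambda>q. frechet_derivative f (at q) y \<bullet> b) has_derivative (\<lambda>x. hess f p x y \<bullet> b)) (at p)"
      by (intro has_derivative_inner_left hess_has_derivative[OF assms(2,3)])
    have "frechet_derivative f (at q) y \<bullet> b = frechet_derivative (\<lambda>q. f q \<bullet> b) (at q) y" if "q \<in> M" for q
      using frechet_derivative_at[OF has_derivative_inner_left[OF smooth_onD_has_derivative[OF assms(2) that]]]
      by metis
    from has_derivative_transform_within_open[OF * assms(1,3) this]
    show ?thesis
      using has_derivative_unique[OF _ hess_has_derivative[OF sm assms(3)]] by metis
  qed
  then show "hess f p v w \<bullet> b = hess f p w v \<bullet> b"
    using hess_symmetric_real[OF assms(1) sm assms(3)] by metis
qed

section \<open>Determinants\<close>

lemma sum_UNIV_option: "(\<Sum>a\<in>UNIV. f a) = f None + (\<Sum>i\<in>UNIV. f (Some i))"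
  for f :: "'n::finite option \<Rightarrow> 'a::comm_monoid_add"
  by (simp add: UNIV_option_conv sum.reindex)

lemma prod_UNIV_option: "(\<Prod>a\<in>UNIV. f a) = f None * (\<Prod>i\<in>UNIV. f (Some i))"
  for f :: "'n::finite option \<Rightarrow> 'a::comm_monoid_mult"
  by (simp add: UNIV_option_conv prod.reindex)

text \<open>In the Leibniz sum only the permutations fixing \<open>None\<close> survive. They are
  the images under \<open>map_permutation\<close> of the permutations of \<open>'n\<close>, with the
  same signs.\<close>

lemma det_option_unit_row:
  fixes A :: "'a::comm_ring_1 ^ 'n option ^ 'n::finite option"
  assumes "\<And>b. A $ None $ b = (if b = None then 1 else 0)"
  shows "det A = det (\<chi> i j. A $ Some i $ Some j)"
proof -
  let ?h = "map_permutation UNIV Some :: ('n \<Rightarrow> 'n) \<Rightarrow> 'n option \<Rightarrow> 'n option"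
  let ?t = "\<lambda>p. of_int (sign p) * (\<Prod>a\<in>UNIV. A $ a $ p a)"
  let ?S = "{p. p permutes (range Some :: 'n option set)}"
  have h_Some [simp]: "?h q (Some i) = Some (q i)" for q i
    by (rule map_permutation_apply) auto
  have h_None [simp]: "?h q None = None" for q
    by (auto simp: map_permutation_def restrict_id_def)
  have h_perm: "?h q permutes range Some" if "q permutes UNIV" for q
    by (rule map_permutation_permutes[OF _ that]) (auto simp: bij_betw_def)
  have fin: "finite {p. p permutes (UNIV :: 'n option set)}"
    by simp
  have sub: "?S \<subseteq> {p. p permutes UNIV}"
    using permutes_subset[of _ "range Some" UNIV] by auto
  have zero: "?t p = 0" if "p \<in> {p. p permutes UNIV} - ?S" for p
  proof -
    have "p None \<noteq> None"
    proof
      assume "p None = None"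
      moreover have "p permutes UNIV" using that by simp
      ultimately have "p permutes range Some"
        by (elim permutes_superset) (metis Diff_iff rangeI not_None_eq)
      then show False using that by simp
    qed
    then have "A $ None $ p None = 0" by (simp add: assms)
    then have "(\<Prod>a\<in>UNIV. A $ a $ p a) = 0" by (simp only: prod_UNIV_option mult_zero_left)
    then show ?thesis by simp
  qed
  have bij: "bij_betw ?h {q. q permutes (UNIV :: 'n set)} ?S"
  proof (rule bij_betw_imageI)
    show "inj_on ?h {q. q permutes UNIV}"
    proof (rule inj_onI, rule ext)
      fix q r i assume "?h q = ?h r"
      then have "?h q (Some i) = ?h r (Some i)" by simp
      then show "q i = r i" by simp
    qed
    show "?h ` {q. q permutes UNIV} = ?S"
    proof (intro equalityI subsetI)
      fix p assume "p \<in> ?S"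
      then have p: "p permutes range Some" by simp
      define q where "q i = the (p (Some i))" for i
      have pS: "p (Some i) = Some (q i)" for i
        using permutes_in_image[OF p, of "Some i"] by (auto simp: q_def)
      have pN: "p None = None"
        using permutes_not_in[OF p, of None] by auto
      have "inj q"
      proof (rule injI)
        fix i j assume "q i = q j"
        then have "p (Some i) = p (Some j)" by (simp add: pS)
        then show "i = j" using permutes_inj[OF p] by (auto dest: injD)
      qed
      then have "bij q" by (simp add: bij_def finite_UNIV_inj_surj)
      then have "q permutes UNIV" by (intro bij_imp_permutes) auto
      moreover have "?h q = p"
      proof
        fix a show "?h q a = p a" by (cases a) (simp_all add: pS pN)
      qed
      ultimately show "p \<in> ?h ` {q. q permutes UNIV}" by blast
    qed (auto intro: h_perm)
  qed
  have "det A = sum ?t {p. p permutes UNIV}"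
    by (simp add: det_def)
  also have "\<dots> = sum ?t ?S"
    by (rule sum.mono_neutral_right[OF fin sub]) (use zero in blast)
  also have "\<dots> = (\<Sum>q | q permutes UNIV. ?t (?h q))"
    by (rule sum.reindex_bij_betw[OF bij, symmetric])
  also have "\<dots> = (\<Sum>q | q permutes (UNIV :: 'n set). of_int (sign q) * (\<Prod>i\<in>UNIV. A $ Some i $ Some (q i)))"
    by (rule sum.cong) (simp_all add: sign_map_permutation prod_UNIV_option assms)
  finally show ?thesis
    by (simp add: det_def)
qed

section \<open>Derivatives of determinants and row operations on ambient frames\<close>

text \<open>In each term of the Leibniz sum the product rule differentiates one factor, that is, one
  row.\<close>

lemma has_derivative_det:
  fixes A :: "'k::finite \<Rightarrow> 'q::real_normed_vector \<Rightarrow> real ^ 'k"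
  assumes "\<And>i. (A i has_derivative A' i) (at p)"
  shows "((\<lambda>q. det (\<chi> i. A i q)) has_derivative
     (\<lambda>v. \<Sum>i\<in>UNIV. det (\<chi> j. if j = i then A' i v else A j p))) (at p)"
proof -
  have comp: "((\<lambda>q. A i q $ k) has_derivative (\<lambda>v. A' i v $ k)) (at p)" for i k
    by (rule bounded_linear.has_derivative[OF bounded_linear_vec_nth assms])
  have "((\<lambda>q. \<Sum>\<sigma> | \<sigma> permutes UNIV. of_int (sign \<sigma>) * (\<Prod>i\<in>UNIV. A i q $ \<sigma> i)) has_derivative
     (\<lambda>v. \<Sum>\<sigma> | \<sigma> permutes UNIV. of_int (sign \<sigma>) *
        (\<Sum>i\<in>UNIV. A' i v $ \<sigma> i * (\<Prod>j\<in>UNIV - {i}. A j p $ \<sigma> j)))) (at p)"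
    by (intro has_derivative_sum has_derivative_mult_right has_derivative_prod comp)
  moreover have "(\<Sum>\<sigma> | \<sigma> permutes UNIV. of_int (sign \<sigma>) *
        (\<Sum>i\<in>UNIV. A' i v $ \<sigma> i * (\<Prod>j\<in>UNIV - {i}. A j p $ \<sigma> j)))
      = (\<Sum>i\<in>UNIV. det (\<chi> j. if j = i then A' i v else A j p))" for v
  proof -
    have "(\<Prod>j\<in>UNIV. (if j = i then A' i v else A j p) $ \<sigma> j)
        = A' i v $ \<sigma> i * (\<Prod>j\<in>UNIV - {i}. A j p $ \<sigma> j)" for i and \<sigma> :: "'k \<Rightarrow> 'k"
      by (subst prod.remove[of _ i]) (auto intro!: prod.cong)
    then show ?thesis
      by (simp add: det_def sum_distrib_left sum.swap[of _ UNIV])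
  qed
  ultimately show ?thesis
    by (simp add: det_def)
qed

text \<open>Pairs are recoded as vectors indexed by \<open>'n option\<close>, so that an ambient
  determinant is an ordinary one with these vectors as rows.\<close>

definition ambient_vec :: "(real ^ 'n::finite) \<times> real \<Rightarrow> real ^ 'n option" where
  "ambient_vec x = (\<chi> b. case b of Some k \<Rightarrow> fst x $ k | None \<Rightarrow> snd x)"

lemma ambient_det_eq: "ambient_det V = det (\<chi> a. ambient_vec (V a))"
  by (simp add: ambient_det_def ambient_vec_def)

lemma linear_ambient_vec: "linear ambient_vec"
  by (rule linearI) (auto simp: ambient_vec_def vec_eq_iff split: option.splits)

lemma bounded_linear_ambient_vec: "bounded_linear ambient_vec"
  using linear_ambient_vec by (simp add: linear_conv_bounded_linear)

lemma ambient_det_update: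
  "ambient_det (V(a := x)) = det (\<chi> b. if b = a then ambient_vec x else ambient_vec (V b))"
  unfolding ambient_det_eq by (rule arg_cong[of _ _ det]) (simp add: vec_eq_iff)

lemma has_derivative_ambient_det:
  assumes "\<And>a. (V a has_derivative V' a) (at p)"
  shows "((\<lambda>q. ambient_det (\<lambda>a. V a q)) has_derivative
     (\<lambda>v. \<Sum>a\<in>UNIV. ambient_det ((\<lambda>b. V b p)(a := V' a v)))) (at p)"
  unfolding ambient_det_update unfolding ambient_det_eq
  by (rule has_derivative_det) (rule bounded_linear.has_derivative[OF bounded_linear_ambient_vec assms])

lemma ambient_det_update_add:
  "ambient_det (V(a := x + y)) = ambient_det (V(a := x)) + ambient_det (V(a := y))"
  unfolding ambient_det_update using det_row_add[of a "\<lambda>_. ambient_vec x" "\<lambda>_. ambient_vec y" "\<lambda>b. ambient_vec (V b)"]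
  by (simp add: linear_add[OF linear_ambient_vec] cong: if_cong)

lemma ambient_det_update_scaleR:
  "ambient_det (V(a := c *\<^sub>R x)) = c * ambient_det (V(a := x))"
  unfolding ambient_det_update
  using det_row_mul[of a c "\<lambda>_. ambient_vec x" "\<lambda>b. ambient_vec (V b)"]
  by (simp add: linear_cmul[OF linear_ambient_vec] scalar_mult_eq_scaleR cong: if_cong)

lemma ambient_det_repeated:
  assumes "a \<noteq> b" "V a = V b"
  shows "ambient_det V = 0"
  unfolding ambient_det_eq
  by (rule det_identical_rows[OF assms(1)]) (simp add: row_def assms(2))

lemma ambient_det_add_multiple:
  assumes "a \<noteq> b"
  shows "ambient_det (V(a := V a + c *\<^sub>R V b)) = ambient_det V"
proof -
  have "ambient_det (V(a := V b)) = 0"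
    by (rule ambient_det_repeated[OF assms]) (use assms in auto)
  then show ?thesis
    by (simp add: ambient_det_update_add ambient_det_update_scaleR)
qed

text \<open>There are \<open>CARD('n) + 1\<close> rows in a space of dimension at most
  \<open>CARD('n)\<close>, so the rank is too small.\<close>

lemma ambient_det_in_range:
  fixes L :: "'p::euclidean_space \<Rightarrow> (real ^ 'n::finite) \<times> real"
  assumes "linear L" "DIM('p) \<le> CARD('n)" "\<And>a. V a \<in> range L"
  shows "ambient_det V = 0"
proof -
  let ?A = "\<chi> a. ambient_vec (V a)"
  have lin: "linear (ambient_vec \<circ> L)"
    by (rule linear_compose[OF assms(1) linear_ambient_vec])
  have "rows ?A \<subseteq> range (ambient_vec \<circ> L)"
  proof
    fix r assume "r \<in> rows ?A"
    then obtain a where "r = ambient_vec (V a)"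
      by (auto simp: rows_def row_def)
    then show "r \<in> range (ambient_vec \<circ> L)"
      using assms(3)[of a] by auto
  qed
  then have "dim (rows ?A) \<le> dim (range (ambient_vec \<circ> L))"
    by (rule dim_subset)
  also have "\<dots> \<le> DIM('p)"
    using dim_image_le[OF lin, of UNIV] by simp
  also have "\<dots> < CARD('n option)"
    using assms(2) by simp
  finally show ?thesis
    by (simp add: ambient_det_eq det_eq_0_rank row_rank_def)
qed

text \<open>The new frame is the old one multiplied by the block matrix with blocks \<open>N\<close>
  and 1: tangent vectors are recombined, while the vector at \<open>None\<close>, later the
  transversal field, stays fixed.\<close>

lemma ambient_det_frame_change:
  fixes N :: "real ^ 'n ^ 'n::finite"
  shows "ambient_det (\<lambda>a. case a of Some i \<Rightarrow> \<Sum>k\<in>UNIV. N $ i $ k *\<^sub>R P (Some k) | None \<Rightarrow> P None)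
     = det N * ambient_det P"
proof -
  let ?B = "\<chi> a b. case a of None \<Rightarrow> if b = None then 1 else 0
     | Some i \<Rightarrow> (case b of None \<Rightarrow> 0 | Some k \<Rightarrow> N $ i $ k) :: real ^ 'n option ^ 'n option"
  interpret lin: linear ambient_vec by (rule linear_ambient_vec)
  have "det ?B = det N"
    by (subst det_option_unit_row) (simp_all add: vec_lambda_unique)
  moreover have "(\<chi> a. ambient_vec (case a of Some i \<Rightarrow> \<Sum>k\<in>UNIV. N $ i $ k *\<^sub>R P (Some k) | None \<Rightarrow> P None))
      = ?B ** (\<chi> a. ambient_vec (P a))"
    by (auto simp: vec_eq_iff matrix_matrix_mult_def sum_UNIV_option lin.sum lin.scaleR split: option.splits)
  ultimately show ?thesis
    by (simp add: ambient_det_eq det_mul)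
qed

section \<open>Transversal fields of a hypersurface\<close>

text \<open>Gives the definite descriptions in \<open>tangential\<close> and
  \<open>transverse\<close> their unique value.\<close>

lemma transversal_decomposition_unique:
  assumes "linear L" "inj L" "x \<notin> range L" "L v + c *\<^sub>R x = L v' + c' *\<^sub>R x"
  shows "v = v'" and "c = c'"
proof -
  interpret linear L by fact
  have eq: "L (v - v') = (c' - c) *\<^sub>R x"
    using assms(4) by (simp add: diff algebra_simps)
  show "c = c'"
  proof (rule ccontr)
    assume "c \<noteq> c'"
    then have "x = L (inverse (c' - c) *\<^sub>R (v - v'))"
      by (simp add: scaleR eq)
    then show False using assms(3) by blast
  qed
  then have "L v = L v'" using eq by (simp add: diff)
  then show "v = v'" using assms(2) by (simp add: inj_eq)
qed

lemma tangential_eq: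
  assumes "linear (frechet_derivative F (at p))" "inj (frechet_derivative F (at p))"
    and "\<xi> p \<notin> range (frechet_derivative F (at p))"
  shows "tangential F \<xi> p (frechet_derivative F (at p) v + c *\<^sub>R \<xi> p) = v"
  unfolding tangential_def
  by (rule the_equality) (use transversal_decomposition_unique[OF assms] in blast)+

lemma transverse_eq:
  assumes "linear (frechet_derivative F (at p))" "inj (frechet_derivative F (at p))"
    and "\<xi> p \<notin> range (frechet_derivative F (at p))"
  shows "transverse F \<xi> p (frechet_derivative F (at p) v + c *\<^sub>R \<xi> p) = c"
  unfolding transverse_def
  by (rule the_equality) (use transversal_decomposition_unique[OF assms] in blast)+

lemma flat_deriv_const: "flat_deriv F (\<lambda>_. v) (\<lambda>_. w) p = hess F p v w"
  by (simp add: flat_deriv_def hess_def)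

text \<open>Since \<open>D\<^sub>X \<xi>\<close> is tangential, replacing \<open>\<xi>\<close> by it in the determinant gives a vanishing term; in the
  other terms the transversal part of \<open>D\<^sub>X Y\<^sub>j\<close> is a multiple of the row \<open>\<xi>\<close>.\<close>

lemma equiaffine_onI:
  fixes F :: "'p::euclidean_space \<Rightarrow> (real ^ 'n::finite) \<times> real"
  assumes M: "open M" "DIM('p) \<le> CARD('n)" and F: "immersion_on M F"
    and \<xi>: "smooth_on M \<xi>" "transversal_on M F \<xi>"
    and tan: "\<And>p v. p \<in> M \<Longrightarrow> frechet_derivative \<xi> (at p) v \<in> range (frechet_derivative F (at p))"
    and dec: "\<And>p v w. p \<in> M \<Longrightarrow> \<exists>z c. hess F p v w = frechet_derivative F (at p) z + c *\<^sub>R \<xi> p"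
  shows "equiaffine_on M F \<xi>"
  unfolding equiaffine_on_def
proof (intro allI impI ballI)
  fix X :: "'p \<Rightarrow> 'p" and Y :: "'n \<Rightarrow> 'p \<Rightarrow> 'p" and p
  assume Y: "\<forall>i. smooth_on M (Y i)" and p: "p \<in> M"
  have sF: "smooth_on M F" and injF: "inj (frechet_derivative F (at p))"
    using F p by (auto simp: immersion_on_def)
  interpret DF: linear "frechet_derivative F (at p)"
    by (rule linear_frechet[OF sF p])
  have tr: "\<xi> p \<notin> range (frechet_derivative F (at p))"
    using \<xi>(2) p by (auto simp: transversal_on_def)
  define V where "V a q = (case a of Some i \<Rightarrow> frechet_derivative F (at q) (Y i q) | None \<Rightarrow> \<xi> q)" for a q
  define V' where "V' a v = (case a of
     Some i \<Rightarrow> frechet_derivative F (at p) (frechet_derivative (Y i) (at p) v) + hess F p v (Y i p)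
   | None \<Rightarrow> frechet_derivative \<xi> (at p) v)" for a v
  have Yd: "(Y i has_derivative frechet_derivative (Y i) (at p)) (at p)" for i
    using Y p smooth_onD_has_derivative by blast
  have DFY: "((\<lambda>q. frechet_derivative F (at q) (Y i q)) has_derivative V' (Some i)) (at p)" for i
    using frechet_derivative_along_has_derivative[OF M(1) sF _ has_derivative_ident Yd, of i] p
    by (simp add: V'_def[abs_def])
  have V: "(V a has_derivative V' a) (at p)" for a
    using DFY smooth_onD_has_derivative[OF \<xi>(1) p]
    by (cases a) (simp_all add: V_def[abs_def] V'_def[abs_def])
  have None_term: "ambient_det ((\<lambda>b. V b p)(None := V' None (X p))) = 0"
    by (rule ambient_det_in_range[OF DF.linear_axioms M(2)])
      (auto simp: V_def V'_def tan[OF p] split: option.splits)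
  have Some_term: "ambient_det ((\<lambda>b. V b p)(Some i := V' (Some i) (X p)))
      = induced_vol F \<xi> p ((\<lambda>i. Y i p)(i := induced_conn F \<xi> X (Y i) p))" for i
  proof -
    obtain z c where zc: "hess F p (X p) (Y i p) = frechet_derivative F (at p) z + c *\<^sub>R \<xi> p"
      using dec[OF p] by blast
    define y where "y = frechet_derivative (Y i) (at p) (X p) + z"
    have flat: "V' (Some i) (X p) = frechet_derivative F (at p) y + c *\<^sub>R V None p"
      by (simp add: V'_def V_def zc y_def DF.add)
    have "flat_deriv F X (Y i) p = frechet_derivative F (at p) y + c *\<^sub>R \<xi> p"
      unfolding flat_deriv_def frechet_derivative_at[OF DFY, symmetric] using flat by (simp add: V_def)
    then have conn: "induced_conn F \<xi> X (Y i) p = y"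
      unfolding induced_conn_def by (simp add: tangential_eq[of F p \<xi>, OF DF.linear_axioms injF tr])
    have zero: "ambient_det ((\<lambda>b. V b p)(Some i := V None p)) = 0"
      by (rule ambient_det_repeated[of "Some i" None]) auto
    have "ambient_det ((\<lambda>b. V b p)(Some i := V' (Some i) (X p)))
        = ambient_det ((\<lambda>b. V b p)(Some i := frechet_derivative F (at p) y))"
      by (simp add: flat ambient_det_update_add ambient_det_update_scaleR zero)
    also have "(\<lambda>b. V b p)(Some i := frechet_derivative F (at p) y)
        = (\<lambda>a. case a of Some j \<Rightarrow> frechet_derivative F (at p) (((\<lambda>i. Y i p)(i := y)) j) | None \<Rightarrow> \<xi> p)"
      by (auto simp: fun_eq_iff V_def split: option.splits)
    finally show ?thesis
      by (simp only: conn induced_vol_def)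
  qed
  have "((\<lambda>q. induced_vol F \<xi> q (\<lambda>i. Y i q)) has_derivative
      (\<lambda>v. \<Sum>a\<in>UNIV. ambient_det ((\<lambda>b. V b p)(a := V' a v)))) (at p)"
    using has_derivative_ambient_det[of V, OF V] unfolding induced_vol_def V_def .
  note deriv = frechet_derivative_at[OF this, symmetric]
  show "frechet_derivative (\<lambda>q. induced_vol F \<xi> q (\<lambda>i. Y i q)) (at p) (X p)
      = (\<Sum>j\<in>UNIV. induced_vol F \<xi> p ((\<lambda>i. Y i p)(j := induced_conn F \<xi> X (Y j) p)))"
    unfolding deriv sum_UNIV_option None_term Some_term by simp
qed

text \<open>Both sides of the volume condition are multiplied by the squared determinant of a change of frame.\<close>

lemma volume_condition_frame_change:
  fixes F :: "'p::real_normed_vector \<Rightarrow> (real ^ 'n::finite) \<times> real" and e :: "'n \<Rightarrow> 'p"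
  assumes "linear (frechet_derivative F (at p))"
    and h: "\<And>x. linear (h x)" "\<And>y. linear (\<lambda>x. h x y)"
    and e: "\<And>v. \<exists>c. v = (\<Sum>k\<in>UNIV. c k *\<^sub>R e k)"
    and vol: "(induced_vol F \<xi> p e)\<^sup>2 = \<bar>det (\<chi> i j. h (e i) (e j))\<bar>"
  shows "(induced_vol F \<xi> p V)\<^sup>2 = \<bar>det (\<chi> i j. h (V i) (V j))\<bar>"
proof -
  interpret DF: linear "frechet_derivative F (at p)" by fact
  have "\<exists>c. \<forall>i. V i = (\<Sum>k\<in>UNIV. c i k *\<^sub>R e k)"
    by (intro choice allI e)
  then obtain c where c: "\<And>i. V i = (\<Sum>k\<in>UNIV. c i k *\<^sub>R e k)"
    by blast
  define N :: "real ^ 'n ^ 'n" where "N = (\<chi> i k. c i k)"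
  define H :: "real ^ 'n ^ 'n" where "H = (\<chi> i j. h (e i) (e j))"
  have "(\<lambda>a. case a of Some i \<Rightarrow> frechet_derivative F (at p) (V i) | None \<Rightarrow> \<xi> p)
      = (\<lambda>a. case a of Some i \<Rightarrow> \<Sum>k\<in>UNIV. N $ i $ k *\<^sub>R
           (case Some k of Some i \<Rightarrow> frechet_derivative F (at p) (e i) | None \<Rightarrow> \<xi> p)
         | None \<Rightarrow> (case None of Some i \<Rightarrow> frechet_derivative F (at p) (e i) | None \<Rightarrow> \<xi> p))"
    by (auto simp: fun_eq_iff N_def c DF.sum DF.scaleR split: option.splits)
  then have "induced_vol F \<xi> p V = det N * induced_vol F \<xi> p e"
    unfolding induced_vol_def by (simp only: ambient_det_frame_change)
  moreover have "(\<chi> i j. h (V i) (V j)) = N ** H ** transpose N"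
  proof -
    have "h (V i) (V j) = (\<Sum>l\<in>UNIV. \<Sum>k\<in>UNIV. c i k * c j l * h (e k) (e l))" for i j
      by (simp add: c linear_sum[OF h(1)] linear_sum[OF h(2)] linear_cmul[OF h(1)] linear_cmul[OF h(2)]
          sum_distrib_left mult_ac)
    then show ?thesis
      by (simp add: vec_eq_iff matrix_matrix_mult_def transpose_def N_def H_def sum_distrib_left mult_ac)
  qed
  ultimately have "(induced_vol F \<xi> p V)\<^sup>2 = (det N)\<^sup>2 * \<bar>det H\<bar>"
    "\<bar>det (\<chi> i j. h (V i) (V j))\<bar> = \<bar>det N\<bar>\<^sup>2 * \<bar>det H\<bar>"
    using vol by (simp_all only: det_mul det_transpose abs_mult power_mult_distrib H_def)
      (simp_all add: power2_eq_square)
  then show ?thesis by simp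
qed

section \<open>The Levi-Civita connection on constant fields\<close>

text \<open>A difference of two such connections is symmetric in its two arguments and skew in the last two of
  \<open>g (D v w) z\<close>, hence zero.\<close>

lemma is_levi_civita_const_unique:
  fixes g :: "'p::real_normed_vector \<Rightarrow> 'p \<Rightarrow> 'p \<Rightarrow> real"
  assumes "is_levi_civita M g nab" "is_levi_civita M g nab'" "p \<in> M"
    and sym: "\<And>x y. g p x y = g p y x" and lin: "\<And>y. linear (\<lambda>x. g p x y)"
    and nondeg: "nondegenerate_form (g p)"
  shows "nab (\<lambda>_. v) (\<lambda>_. w) p = nab' (\<lambda>_. v) (\<lambda>_. w) p"
proof -
  have torsion: "N (\<lambda>_. v) (\<lambda>_. w) p = N (\<lambda>_. w) (\<lambda>_. v) p"
    and metric: "frechet_derivative (\<lambda>q. g q w z) (at p) v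
        = g p (N (\<lambda>_. v) (\<lambda>_. w) p) z + g p w (N (\<lambda>_. v) (\<lambda>_. z) p)"
    if "is_levi_civita M g N" for N v w z
    \<comment> \<open>Constant fields commute, so vanishing torsion becomes symmetry; the scalar
      function 0 is a placeholder.\<close>
    using that[unfolded is_levi_civita_def, rule_format, of "\<lambda>_. v" "\<lambda>_. w" "\<lambda>_. z" "\<lambda>_. 0" p] assms(3)
    by auto
  define D where "D v w = nab (\<lambda>_. v) (\<lambda>_. w) p - nab' (\<lambda>_. v) (\<lambda>_. w) p" for v w
  have D_sym: "D v w = D w v" for v w
    using torsion[OF assms(1), of v w] torsion[OF assms(2), of v w] by (simp add: D_def)
  have D_skew: "g p (D v w) z = - g p (D v z) w" for v w z
    using metric[OF assms(1), of w z v] metric[OF assms(2), of w z v]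
    by (simp add: D_def linear_diff[OF lin] sym[of w])
  \<comment> \<open>Three symmetric and three skew exchanges, applied alternately, lead back to the
    same term with the opposite sign.\<close>
  have "g p (D v w) z = 0" for z
    by (smt (verit) D_sym D_skew)
  then have "D v w = 0"
    using nondeg by (simp add: nondegenerate_form_def)
  then show ?thesis by (simp add: D_def)
qed

text \<open>Exhibiting one connection evaluates the chosen one: existence makes the choice
  legitimate, and uniqueness on constant fields makes it immaterial there.\<close>

lemma levi_civita_const_eq:
  fixes g :: "'p::real_normed_vector \<Rightarrow> 'p \<Rightarrow> 'p \<Rightarrow> real"
  assumes "is_levi_civita M g nab" "p \<in> M"
    and "\<And>x y. g p x y = g p y x" "\<And>y. linear (\<lambda>x. g p x y)" "nondegenerate_form (g p)"
  shows "levi_civita M g (\<lambda>_. v) (\<lambda>_. w) p = nab (\<lambda>_. v) (\<lambda>_. w) p"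
  unfolding levi_civita_def
  by (rule is_levi_civita_const_unique[OF someI[of "is_levi_civita M g", OF assms(1)] assms])

section \<open>Centred quadrics\<close>

text \<open>With \<open>B\<close> the inverse of the equi-affine map of the quadric, this is the
  diagonal form in the coordinates in which the quadric is standard.\<close>

lemma diagonal_form_matrix:
  fixes B :: "real ^ 'n ^ 'n" and s :: "'n \<Rightarrow> real"
  shows "x \<bullet> ((transpose B ** (\<chi> i j. if i = j then s i else 0) ** B) *v y)
    = (\<Sum>i\<in>UNIV. s i * (B *v x) $ i * (B *v y) $ i)"
proof -
  let ?D = "\<chi> i j. if i = j then s i else 0 :: real ^ 'n ^ 'n"
  have D: "(?D *v z) $ i = s i * z $ i" for z i
    by (simp add: matrix_vector_mult_def if_distrib[of "\<lambda>c. c * _"] cong: if_cong)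
  have "x \<bullet> (transpose B *v z) = (B *v x) \<bullet> z" for z
    by (metis dot_lmul_matrix inner_commute transpose_matrix_vector)
  then have "x \<bullet> ((transpose B ** ?D ** B) *v y) = (B *v x) \<bullet> (?D *v (B *v y))"
    by (simp only: matrix_vector_mul_assoc[symmetric])
  also have "\<dots> = (\<Sum>i\<in>UNIV. s i * (B *v x) $ i * (B *v y) $ i)"
    by (simp add: inner_vec_def D mult_ac)
  finally show ?thesis .
qed

text \<open>Otherwise Cauchy-Schwarz would give
  \<open>(x $ k * y $ k)^2 \<le> ((x $ k)^2 - 1) * (y $ k)^2\<close>, hence \<open>y $ k = 0\<close>
  and then \<open>y = 0\<close>. This makes the metric positive on the tangent spaces of the
  hyperboloid.\<close>

lemma orthogonal_to_timelike_positive: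
  fixes x y :: "real ^ 'n::finite"
  assumes x: "(\<Sum>i\<in>-{k}. (x $ i)\<^sup>2) - (x $ k)\<^sup>2 = -1"
    and orth: "(\<Sum>i\<in>-{k}. x $ i * y $ i) = x $ k * y $ k" and "y \<noteq> 0"
  shows "(\<Sum>i\<in>-{k}. (y $ i)\<^sup>2) > (y $ k)\<^sup>2"
proof (rule ccontr)
  assume "\<not> ?thesis"
  then have le: "(\<Sum>i\<in>-{k}. (y $ i)\<^sup>2) \<le> (y $ k)\<^sup>2" by simp
  have "(x $ k)\<^sup>2 * (y $ k)\<^sup>2 = (\<Sum>i\<in>-{k}. x $ i * y $ i)\<^sup>2"
    by (simp add: orth power_mult_distrib)
  also have "\<dots> \<le> (\<Sum>i\<in>-{k}. (x $ i)\<^sup>2) * (\<Sum>i\<in>-{k}. (y $ i)\<^sup>2)"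
    by (rule Cauchy_Schwarz_ineq_sum)
  also have "\<dots> \<le> (\<Sum>i\<in>-{k}. (x $ i)\<^sup>2) * (y $ k)\<^sup>2"
    by (rule mult_left_mono[OF le]) (simp add: sum_nonneg)
  also have "(\<Sum>i\<in>-{k}. (x $ i)\<^sup>2) = (x $ k)\<^sup>2 - 1"
    using x by simp
  finally have yk: "y $ k = 0"
    by (simp add: algebra_simps)
  then have "(\<Sum>i\<in>-{k}. (y $ i)\<^sup>2) = 0"
    using le by (intro antisym) (simp_all add: sum_nonneg)
  then have "\<forall>i\<in>-{k}. y $ i = 0"
    by (simp add: sum_nonneg_eq_0_iff)
  then have "y = 0"
    using yk by (auto simp: vec_eq_iff)
  then show False using assms(3) by simp
qed

text \<open>Sphere and hyperboloid are merged into one symmetric matrix; the signature is remembered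
  through \<epsilon> and through positivity on the complement of \<open>\<phi> u\<close>. The
  determinant is 1 or -1 because the linear map is equi-affine and the standard forms have such
  determinants.\<close>

lemma eps_quadric_form:
  fixes \<phi> :: "real ^ 'm::finite \<Rightarrow> real ^ 'n::finite"
  assumes "eps_quadric \<epsilon> U \<phi>"
  obtains G :: "real ^ 'n ^ 'n" where "\<bar>det G\<bar> = 1" "\<And>x y. x \<bullet> (G *v y) = y \<bullet> (G *v x)"
    "\<And>u. u \<in> U \<Longrightarrow> \<phi> u \<bullet> (G *v \<phi> u) = \<epsilon>"
    "\<And>u y. u \<in> U \<Longrightarrow> \<phi> u \<bullet> (G *v y) = 0 \<Longrightarrow> y \<noteq> 0 \<Longrightarrow> y \<bullet> (G *v y) > 0"
proof -
  obtain A :: "real ^ 'n ^ 'n" where A: "det A = 1" and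
    cases: "\<epsilon> = 1 \<and> \<phi> ` U \<subseteq> (*v) A ` {x. (\<Sum>i\<in>UNIV. (x $ i)\<^sup>2) = 1} \<or>
      \<epsilon> = -1 \<and> (\<exists>k. \<phi> ` U \<subseteq> (*v) A ` {x. (\<Sum>i\<in>-{k}. (x $ i)\<^sup>2) - (x $ k)\<^sup>2 = -1 \<and> x $ k > 0})"
    using assms unfolding eps_quadric_def by blast
  obtain B where B: "B ** A = mat 1" "A ** B = mat 1"
    using A invertible_det_nz[of A] unfolding invertible_def by auto
  have BA: "B *v (A *v x) = x" for x
    by (simp add: matrix_vector_mul_assoc B)
  have B0: "B *v y \<noteq> 0" if "y \<noteq> 0" for y
    using that B(2) by (metis matrix_vector_mul_assoc matrix_vector_mul_lid matrix_vector_mult_0_right)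
  have "det B = 1"
    using arg_cong[OF B(1), of det] A by (simp add: det_mul)
  define G where "G s = transpose B ** (\<chi> i j. if i = j then s i else 0) ** B" for s :: "'n \<Rightarrow> real"
  have form: "x \<bullet> (G s *v y) = (\<Sum>i\<in>UNIV. s i * (B *v x) $ i * (B *v y) $ i)" for s x y
    unfolding G_def by (rule diagonal_form_matrix)
  have sym: "x \<bullet> (G s *v y) = y \<bullet> (G s *v x)" for s x y
    by (simp add: form mult_ac)
  have detG: "det (G s) = (\<Prod>i\<in>UNIV. s i)" for s
    by (simp add: G_def det_mul \<open>det B = 1\<close> det_diagonal)
  from cases show thesis
  proof
    assume *: "\<epsilon> = 1 \<and> \<phi> ` U \<subseteq> (*v) A ` {x. (\<Sum>i\<in>UNIV. (x $ i)\<^sup>2) = 1}"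
    show thesis
    proof (rule that[of "G (\<lambda>_. 1)"])
      show "\<phi> u \<bullet> (G (\<lambda>_. 1) *v \<phi> u) = \<epsilon>" if "u \<in> U" for u
      proof -
        from * that obtain x where "\<phi> u = A *v x" "(\<Sum>i\<in>UNIV. (x $ i)\<^sup>2) = 1" by auto
        then show ?thesis using * by (simp add: form BA power2_eq_square)
      qed
      show "y \<bullet> (G (\<lambda>_. 1) *v y) > 0" if "y \<noteq> 0" for y
      proof -
        have "y \<bullet> (G (\<lambda>_. 1) *v y) = (B *v y) \<bullet> (B *v y)"
          unfolding form by (simp add: inner_vec_def)
        then show ?thesis using B0[OF that] by simp
      qed
    qed (simp_all add: detG sym)
  next
    assume *: "\<epsilon> = -1 \<and> (\<exists>k. \<phi> ` U \<subseteq> (*v) A ` {x. (\<Sum>i\<in>-{k}. (x $ i)\<^sup>2) - (x $ k)\<^sup>2 = -1 \<and> x $ k > 0})"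
    then obtain k where k: "\<phi> ` U \<subseteq> (*v) A ` {x. (\<Sum>i\<in>-{k}. (x $ i)\<^sup>2) - (x $ k)\<^sup>2 = -1 \<and> x $ k > 0}"
      by blast
    define s where "s i = (if i = k then -1 else 1 :: real)" for i
    have s: "x \<bullet> (G s *v y) = (\<Sum>i\<in>-{k}. (B *v x) $ i * (B *v y) $ i) - (B *v x) $ k * (B *v y) $ k" for x y
    proof -
      have "x \<bullet> (G s *v y) = s k * (B *v x) $ k * (B *v y) $ k
          + (\<Sum>i\<in>-{k}. s i * (B *v x) $ i * (B *v y) $ i)"
        unfolding form by (subst sum.remove[of _ k]) (auto simp: Compl_eq_Diff_UNIV)
      also have "(\<Sum>i\<in>-{k}. s i * (B *v x) $ i * (B *v y) $ i) = (\<Sum>i\<in>-{k}. (B *v x) $ i * (B *v y) $ i)"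
        by (rule sum.cong) (auto simp: s_def)
      moreover have "s k = -1" by (simp add: s_def)
      ultimately show ?thesis by simp
    qed
    show thesis
    proof (rule that[of "G s"])
      have "(\<Prod>i\<in>UNIV. \<bar>s i\<bar>) = 1"
        by (rule prod.neutral) (simp add: s_def)
      then show "\<bar>det (G s)\<bar> = 1"
        by (simp add: detG abs_prod)
      show "\<phi> u \<bullet> (G s *v \<phi> u) = \<epsilon>" if "u \<in> U" for u
      proof -
        from k that obtain x where "\<phi> u = A *v x" "(\<Sum>i\<in>-{k}. (x $ i)\<^sup>2) - (x $ k)\<^sup>2 = -1" by auto
        then show ?thesis using * by (simp add: s BA power2_eq_square)
      qed
      show "y \<bullet> (G s *v y) > 0" if "u \<in> U" "\<phi> u \<bullet> (G s *v y) = 0" "y \<noteq> 0" for u y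
      proof -
        from k that(1) obtain x where x: "\<phi> u = A *v x" "(\<Sum>i\<in>-{k}. (x $ i)\<^sup>2) - (x $ k)\<^sup>2 = -1" by auto
        have "(\<Sum>i\<in>-{k}. ((B *v y) $ i)\<^sup>2) > ((B *v y) $ k)\<^sup>2"
          using that(2) by (intro orthogonal_to_timelike_positive[OF x(2) _ B0[OF that(3)]]) (simp add: s x(1) BA)
        then show ?thesis by (simp add: s power2_eq_square)
      qed
    qed (simp add: sym)
  qed
qed

section \<open>The quadric with its position vector as transversal field\<close>

locale quadric_immersion =
  fixes \<phi> :: "real ^ 'm::finite \<Rightarrow> real ^ 'n::finite" and U :: "(real ^ 'm) set"
    and G :: "real ^ 'n ^ 'n" and \<epsilon> :: real
  assumes card_n: "CARD('n) = CARD('m) + 1"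
    and eps: "\<epsilon> \<in> {-1, 1}" and open_U: "open U" and imm: "immersion_on U \<phi>"
    and det_G: "\<bar>det G\<bar> = 1" and G_sym: "x \<bullet> (G *v y) = y \<bullet> (G *v x)"
    and quadric: "u \<in> U \<Longrightarrow> \<phi> u \<bullet> (G *v \<phi> u) = \<epsilon>"
    and G_pos: "u \<in> U \<Longrightarrow> \<phi> u \<bullet> (G *v y) = 0 \<Longrightarrow> y \<noteq> 0 \<Longrightarrow> y \<bullet> (G *v y) > 0"
begin

abbreviation D\<phi> :: "real ^ 'm \<Rightarrow> real ^ 'm \<Rightarrow> real ^ 'n"
  where "D\<phi> u \<equiv> frechet_derivative \<phi> (at u)"

definition Q :: "real ^ 'n \<Rightarrow> real ^ 'n \<Rightarrow> real" where "Q x y = x \<bullet> (G *v y)"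

definition quadric_metric :: "real ^ 'm \<Rightarrow> real ^ 'm \<Rightarrow> real ^ 'm \<Rightarrow> real" where
  "quadric_metric u v w = Q (D\<phi> u v) (D\<phi> u w)"

text \<open>The second \<phi> is the transversal field: this is the connection induced by the
  centro-affine normalisation, evaluated on constant fields.\<close>

definition quadric_conn :: "real ^ 'm \<Rightarrow> real ^ 'm \<Rightarrow> real ^ 'm \<Rightarrow> real ^ 'm" where
  "quadric_conn u v w = tangential \<phi> \<phi> u (hess \<phi> u v w)"

lemma eps_square: "\<epsilon> * \<epsilon> = 1" and eps_nz: "\<epsilon> \<noteq> 0"
  using eps by auto

lemma smooth_\<phi>: "smooth_on U \<phi>" and inj_D\<phi>: "u \<in> U \<Longrightarrow> inj (D\<phi> u)"
  using imm by (auto simp: immersion_on_def)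

lemma linear_D\<phi>: "u \<in> U \<Longrightarrow> linear (D\<phi> u)"
  by (rule linear_frechet[OF smooth_\<phi>])

lemma bounded_bilinear_Q: "bounded_bilinear Q"
  unfolding Q_def
  by (rule bounded_bilinear.comp[OF bounded_bilinear_inner bounded_linear_ident matrix_vector_mul_bounded_linear])

lemma Q_sym: "Q x y = Q y x"
  unfolding Q_def by (rule G_sym)

lemmas Q_simps [simp] =
  bounded_bilinear.add_left[OF bounded_bilinear_Q] bounded_bilinear.add_right[OF bounded_bilinear_Q]
  bounded_bilinear.scaleR_left[OF bounded_bilinear_Q] bounded_bilinear.scaleR_right[OF bounded_bilinear_Q]
  bounded_bilinear.zero_left[OF bounded_bilinear_Q] bounded_bilinear.zero_right[OF bounded_bilinear_Q]

lemma Q_\<phi>_\<phi>: "u \<in> U \<Longrightarrow> Q (\<phi> u) (\<phi> u) = \<epsilon>"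
  unfolding Q_def by (rule quadric)

lemma Q_\<phi>_D\<phi>:
  assumes "u \<in> U"
  shows "Q (\<phi> u) (D\<phi> u v) = 0"
proof -
  have d: "((\<lambda>u. Q (\<phi> u) (\<phi> u)) has_derivative (\<lambda>v. Q (\<phi> u) (D\<phi> u v) + Q (D\<phi> u v) (\<phi> u))) (at u)"
    by (intro bounded_bilinear.FDERIV[OF bounded_bilinear_Q] smooth_onD_has_derivative[OF smooth_\<phi> assms])
  have "((\<lambda>u. Q (\<phi> u) (\<phi> u)) has_derivative (\<lambda>v. 0)) (at u)"
    by (rule has_derivative_transform_within_open[OF has_derivative_const[of \<epsilon>] open_U assms])
      (simp add: Q_\<phi>_\<phi>)
  from fun_cong[OF has_derivative_unique[OF d this], of v] show ?thesis
    by (simp add: Q_sym)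
qed

lemma Q_\<phi>_hess:
  assumes "u \<in> U"
  shows "Q (\<phi> u) (hess \<phi> u v w) = - quadric_metric u v w"
proof -
  have d: "((\<lambda>u. Q (\<phi> u) (D\<phi> u w)) has_derivative
      (\<lambda>v. Q (\<phi> u) (hess \<phi> u v w) + Q (D\<phi> u v) (D\<phi> u w))) (at u)"
    by (intro bounded_bilinear.FDERIV[OF bounded_bilinear_Q] smooth_onD_has_derivative[OF smooth_\<phi> assms]
        hess_has_derivative[OF smooth_\<phi> assms])
  have "((\<lambda>u. Q (\<phi> u) (D\<phi> u w)) has_derivative (\<lambda>v. 0)) (at u)"
    by (rule has_derivative_transform_within_open[OF has_derivative_const[of 0] open_U assms])
      (simp add: Q_\<phi>_D\<phi>)
  from fun_cong[OF has_derivative_unique[OF d this], of v] show ?thesis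
    by (simp add: quadric_metric_def)
qed

lemma \<phi>_transversal: "u \<in> U \<Longrightarrow> \<phi> u \<notin> range (D\<phi> u)"
  using Q_\<phi>_\<phi>[of u] Q_\<phi>_D\<phi>[of u] eps_nz by auto

lemma quadric_metric_sym: "quadric_metric u v w = quadric_metric u w v"
  unfolding quadric_metric_def by (rule Q_sym)

lemma linear_quadric_metric:
  assumes "u \<in> U"
  shows "linear (quadric_metric u v)"
proof -
  interpret linear "D\<phi> u" by (rule linear_D\<phi>[OF assms])
  show ?thesis by (rule linearI) (simp_all add: quadric_metric_def add scaleR)
qed

lemma quadric_metric_pos:
  assumes "u \<in> U" "v \<noteq> 0"
  shows "quadric_metric u v v > 0"
proof -
  interpret linear "D\<phi> u" by (rule linear_D\<phi>[OF assms(1)])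
  have "D\<phi> u v \<noteq> 0"
    using inj_D\<phi>[OF assms(1)] assms(2) zero by (metis injD)
  then show ?thesis
    using G_pos[OF assms(1)] Q_\<phi>_D\<phi>[OF assms(1)] by (simp add: quadric_metric_def Q_def)
qed

text \<open>The map from \<open>(c, v)\<close> to the right-hand side is injective by
  transversality, and surjective because \<open>CARD('n) = CARD('m) + 1\<close>.\<close>

lemma quadric_decomposition:
  assumes "u \<in> U"
  shows "\<exists>v c. y = D\<phi> u v + c *\<^sub>R \<phi> u"
proof -
  interpret D: linear "D\<phi> u" by (rule linear_D\<phi>[OF assms])
  let ?L = "\<lambda>(c, v). D\<phi> u v + c *\<^sub>R \<phi> u"
  have lin: "linear ?L"
    by (rule linearI) (auto simp: D.add D.scaleR algebra_simps)
  have "inj ?L"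
    unfolding inj_on_def
    using transversal_decomposition_unique[OF D.linear_axioms inj_D\<phi>[OF assms] \<phi>_transversal[OF assms]]
    by auto
  then have "dim (range ?L) = DIM(real \<times> (real ^ 'm))"
    using dim_image_eq[OF lin, of UNIV] by simp
  then have "dim (range ?L) = DIM(real ^ 'n)"
    by (simp add: card_n)
  then have "span (range ?L) = UNIV"
    by (simp only: dim_eq_full)
  moreover have "span (range ?L) = range ?L"
    using linear_subspace_image[OF lin subspace_UNIV] by (simp only: span_eq_iff)
  ultimately have "y \<in> range ?L" by simp
  then show ?thesis by auto
qed

lemma hess_\<phi>:
  assumes "u \<in> U"
  shows "hess \<phi> u v w = D\<phi> u (quadric_conn u v w) - (\<epsilon> * quadric_metric u v w) *\<^sub>R \<phi> u"
proof -
  obtain z c where zc: "hess \<phi> u v w = D\<phi> u z + c *\<^sub>R \<phi> u"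
    using quadric_decomposition[OF assms] by blast
  \<comment> \<open>Pairing with \<open>\<phi> u\<close> isolates the coefficient \<open>c\<close>;
    division by \<epsilon> is multiplication by \<epsilon>.\<close>
  have "- quadric_metric u v w = c * \<epsilon>"
    using Q_\<phi>_hess[OF assms, of v w] by (simp add: zc Q_\<phi>_D\<phi>[OF assms] Q_\<phi>_\<phi>[OF assms])
  then have "c = - (\<epsilon> * quadric_metric u v w)"
    using eps_square by (metis minus_mult_right mult.assoc mult.commute mult.right_neutral)
  moreover have "quadric_conn u v w = z"
    unfolding quadric_conn_def zc
    by (rule tangential_eq[OF linear_D\<phi> inj_D\<phi> \<phi>_transversal]) (fact assms)+
  ultimately show ?thesis using zc by simp
qed

lemma quadric_conn_sym:
  assumes "u \<in> U"
  shows "quadric_conn u v w = quadric_conn u w v"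
  unfolding quadric_conn_def by (simp add: hess_symmetric[OF open_U smooth_\<phi> assms, of v w])

text \<open>Its image under the injective \<open>D\<phi> u\<close> is a combination of the second
  derivative and the metric, both linear.\<close>

lemma linear_quadric_conn:
  assumes "u \<in> U"
  shows "linear (quadric_conn u v)"
proof -
  interpret D: linear "D\<phi> u" by (rule linear_D\<phi>[OF assms])
  interpret H: linear "hess \<phi> u v" by (rule linear_hess_right[OF open_U smooth_\<phi> assms])
  interpret g: linear "quadric_metric u v" by (rule linear_quadric_metric[OF assms])
  have D: "D\<phi> u (quadric_conn u v w) = hess \<phi> u v w + (\<epsilon> * quadric_metric u v w) *\<^sub>R \<phi> u" for w
    by (simp add: hess_\<phi>[OF assms])
  show ?thesis
    by (rule linearI; rule injD[OF inj_D\<phi>[OF assms]])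
      (simp_all add: D D.add D.scaleR H.add H.scaleR g.add g.scaleR algebra_simps)
qed

lemma Q_hess_D\<phi>:
  assumes "u \<in> U"
  shows "Q (hess \<phi> u v w) (D\<phi> u z) = quadric_metric u (quadric_conn u v w) z"
proof -
  have "Q (\<phi> u) (D\<phi> u z) = 0" by (rule Q_\<phi>_D\<phi>[OF assms])
  then show ?thesis
    by (simp add: hess_\<phi>[OF assms] quadric_metric_def diff_conv_add_uminus flip: scaleR_minus_left
        del: add_uminus_conv_diff)
qed

text \<open>Metric compatibility of \<open>quadric_conn\<close>, stated for fields along a map into
  \<open>U\<close>. The warped product applies it with \<open>u = snd\<close>, where the fields may
  also depend on t.\<close>

lemma quadric_metric_along_has_derivative:
  assumes "u p \<in> U" "(u has_derivative du) (at p)" "(Y has_derivative dY) (at p)" "(Z has_derivative dZ) (at p)"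
  shows "((\<lambda>q. quadric_metric (u q) (Y q) (Z q)) has_derivative
    (\<lambda>x. quadric_metric (u p) (dY x + quadric_conn (u p) (du x) (Y p)) (Z p)
       + quadric_metric (u p) (Y p) (dZ x + quadric_conn (u p) (du x) (Z p)))) (at p)"
proof -
  interpret D: linear "D\<phi> (u p)" by (rule linear_D\<phi>[OF assms(1)])
  have "((\<lambda>q. quadric_metric (u q) (Y q) (Z q)) has_derivative
     (\<lambda>x. Q (D\<phi> (u p) (Y p)) (D\<phi> (u p) (dZ x) + hess \<phi> (u p) (du x) (Z p))
        + Q (D\<phi> (u p) (dY x) + hess \<phi> (u p) (du x) (Y p)) (D\<phi> (u p) (Z p)))) (at p)"
    unfolding quadric_metric_def
    by (intro bounded_bilinear.FDERIV[OF bounded_bilinear_Q]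
        frechet_derivative_along_has_derivative[OF open_U smooth_\<phi> assms(1,2)] assms(3,4))
  moreover have "Q (D\<phi> (u p) y) (hess \<phi> (u p) x z) = quadric_metric (u p) y (quadric_conn (u p) x z)" for x y z
    using Q_hess_D\<phi>[OF assms(1)] Q_sym quadric_metric_sym by metis
  ultimately show ?thesis
    by (simp add: Q_hess_D\<phi>[OF assms(1)] D.add quadric_metric_def add_ac)
qed

end

section \<open>Rotations fixing a vector\<close>

text \<open>Pairing with \<open>e i\<close> recovers the coefficient at \<open>i\<close> up to the
  factor \<open>c\<close>, so the coefficient map is injective, and between spaces of equal
  dimension surjective.\<close>

lemma orthogonal_family_spans:
  fixes e :: "'m::finite \<Rightarrow> real ^ 'm"
  assumes "\<And>x. linear (k x)" and "\<And>i j. k (e i) (e j) = (if i = j then c else 0)" and "c \<noteq> (0::real)"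
  shows "\<exists>a. v = (\<Sum>j\<in>UNIV. a j *\<^sub>R e j)"
proof -
  let ?L = "\<lambda>a :: real ^ 'm. \<Sum>j\<in>UNIV. a $ j *\<^sub>R e j"
  have lin: "linear ?L"
    by (intro linear_compose_sum ballI linearI) (simp_all add: scaleR_add_left)
  have coeff: "k (e i) (?L a) = c * a $ i" for i a
    by (simp add: linear_sum[OF assms(1)] linear_cmul[OF assms(1)] assms(2) if_distrib cong: if_cong)
  have "inj ?L"
  proof (rule injI)
    fix a b assume "?L a = ?L b"
    then have "c * a $ i = c * b $ i" for i
      by (metis coeff)
    then show "a = b" using assms(3) by (simp add: vec_eq_iff)
  qed
  then have "surj ?L"
    by (rule linear_injective_imp_surjective[OF lin]) simp
  then have "\<exists>a. v = ?L a"
    by (rule surjD)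
  then obtain a where "v = ?L a" ..
  then show ?thesis
    by (rule exI[of _ "\<lambda>j. a $ j"])
qed

text \<open>Orthogonality to \<open>(r, 0)\<close> kills first components, so the basis lies in the
  second factor, where it is \<open>k\<close>-orthogonal with common square
  \<open>inverse \<beta>\<close> and therefore spans. Hence \<open>g\<close> splits, and
  orthogonality of its matrix becomes invariance of \<open>k\<close>.\<close>

lemma restricts_to_SO_isometry:
  fixes k :: "real ^ 'm::finite \<Rightarrow> real ^ 'm \<Rightarrow> real"
  assumes k: "\<And>x. linear (k x)" "\<And>y. linear (\<lambda>x. k x y)" and nz: "\<alpha> \<noteq> 0" "\<beta> \<noteq> 0" "r \<noteq> 0"
    and b: "\<And>x y. b x y = \<alpha> * fst x * fst y + \<beta> * k (snd x) (snd y)"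
    and g: "linear g" "g (r, 0) = (r, 0)" "restricts_to_SO b (r, 0) g"
  obtains R where "linear R" "\<And>x. g x = (fst x, R (snd x))" "\<And>v w. k (R v) (R w) = k v w"
proof -
  interpret g: linear g by fact
  have k0 [simp]: "k 0 y = 0" for y using linear_0[OF k(2)] .
  obtain e :: "'m \<Rightarrow> real \<times> (real ^ 'm)" and A :: "real ^ 'm ^ 'm"
    where e: "\<And>i. b (r, 0) (e i) = 0" "\<And>i j. b (e i) (e j) = (if i = j then 1 else 0)"
      and A: "rotation_matrix A" and ge: "\<And>j. g (e j) = (\<Sum>i\<in>UNIV. A $ i $ j *\<^sub>R e i)"
    using g(3) unfolding restricts_to_SO_def by blast
  define f where "f i = snd (e i)" for i
  have e0: "e i = (0, f i)" for i
    using e(1)[of i] nz by (simp add: b f_def prod_eq_iff)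
  have kf: "k (f i) (f j) = (if i = j then inverse \<beta> else 0)" for i j
    using e(2)[of i j] nz(2) by (auto simp: b e0 field_simps split: if_splits)
  have spans: "\<exists>a. v = (\<Sum>j\<in>UNIV. a j *\<^sub>R f j)" for v
    using orthogonal_family_spans[of k f "inverse \<beta>", OF k(1) kf] nz(2) by simp
  define R where "R v = snd (g (0, v))" for v
  have linR: "linear R"
    by (rule linearI) (simp_all add: R_def flip: snd_add snd_scaleR g.add g.scaleR)
  interpret R: linear R by (rule linR)
  have gf: "g (0, f j) = (0, \<Sum>i\<in>UNIV. A $ i $ j *\<^sub>R f i)" for j
    using ge[of j] by (simp add: e0 prod_eq_iff fst_sum snd_sum)
  have g0: "g (0, v) = (0, R v)" for v
  proof -
    obtain a where a: "v = (\<Sum>j\<in>UNIV. a j *\<^sub>R f j)" using spans by blast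
    have "(0, v) = (\<Sum>j\<in>UNIV. a j *\<^sub>R (0::real, f j))"
      by (simp add: a prod_eq_iff fst_sum snd_sum)
    then have "g (0, v) = (\<Sum>j\<in>UNIV. a j *\<^sub>R g (0, f j))"
      by (simp only: g.sum g.scaleR)
    then have "fst (g (0, v)) = 0" by (simp add: gf fst_sum)
    then show ?thesis by (simp add: R_def prod_eq_iff)
  qed
  have g1: "g (1, 0) = (1, 0)"
    using g(2) g.scaleR[of "inverse r" "(r, 0)"] nz(3) by simp
  have "g x = (fst x, R (snd x))" for x
  proof -
    have "x = fst x *\<^sub>R (1, 0) + (0, snd x)" by (simp add: prod_eq_iff)
    then have "g x = fst x *\<^sub>R g (1, 0) + g (0, snd x)" by (metis g.add g.scaleR)
    then show ?thesis by (simp add: g1 g0)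
  qed
  moreover have "k (R v) (R w) = k v w" for v w
  proof -
    have orth: "(\<Sum>i\<in>UNIV. A $ i $ j * A $ i $ l) = (if j = l then 1 else 0)" for j l
    proof -
      have "transpose A ** A = mat 1"
        using A by (simp only: rotation_matrix_def orthogonal_matrix_def)
      then have "(transpose A ** A) $ j $ l = mat 1 $ j $ l"
        by (rule arg_cong)
      then show ?thesis
        by (simp add: matrix_matrix_mult_def transpose_def mat_def)
    qed
    have Rf: "R (f j) = (\<Sum>i\<in>UNIV. A $ i $ j *\<^sub>R f i)" for j
      using gf[of j] by (simp add: R_def)
    have kR: "k (R (f j)) (R (f l)) = k (f j) (f l)" for j l
    proof -
      have "k (R (f j)) (R (f l)) = (\<Sum>i\<in>UNIV. A $ i $ j * A $ i $ l) * inverse \<beta>"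
        by (simp add: Rf linear_sum[OF k(1)] linear_sum[OF k(2)] linear_cmul[OF k(1)] linear_cmul[OF k(2)]
            kf if_distrib sum_distrib_left sum_distrib_right mult_ac cong: if_cong)
      then show ?thesis by (simp add: orth kf)
    qed
    obtain a c where "v = (\<Sum>j\<in>UNIV. a j *\<^sub>R f j)" "w = (\<Sum>j\<in>UNIV. c j *\<^sub>R f j)"
      using spans by blast
    then show ?thesis
      by (simp add: R.sum R.scaleR linear_sum[OF k(1)] linear_sum[OF k(2)] linear_cmul[OF k(1)] linear_cmul[OF k(2)] kR)
  qed
  ultimately show thesis
    by (rule that[OF linR])
qed

section \<open>Gram determinants of ambient frames\<close>

text \<open>The Gram matrix is the block matrix with blocks \<open>G\<close> and 1, placed between
  the matrix of the frame and its transpose.\<close>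

lemma ambient_det_gram:
  fixes G :: "real ^ 'n ^ 'n::finite"
  shows "(ambient_det P)\<^sup>2 * det G = det (\<chi> a b. fst (P a) \<bullet> (G *v fst (P b)) + snd (P a) * snd (P b))"
proof -
  let ?P = "\<chi> a. ambient_vec (P a)"
  let ?G = "\<chi> a b. case a of None \<Rightarrow> if b = None then 1 else 0
     | Some i \<Rightarrow> (case b of None \<Rightarrow> 0 | Some k \<Rightarrow> G $ i $ k) :: real ^ 'n option ^ 'n option"
  have "det ?G = det G"
    by (subst det_option_unit_row) (simp_all add: vec_lambda_unique)
  moreover have "(\<chi> a b. fst (P a) \<bullet> (G *v fst (P b)) + snd (P a) * snd (P b)) = ?P ** (?G ** transpose ?P)"
    by (simp add: vec_eq_iff matrix_matrix_mult_def transpose_def sum_UNIV_option ambient_vec_def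
        inner_vec_def matrix_vector_mult_def)
  ultimately show ?thesis
    by (simp add: det_mul ambient_det_eq power2_eq_square)
qed

section \<open>Warped quadrics\<close>

text \<open>\<mu> and \<nu> enter as given data; their existence is settled separately. The absolute
  values in \<open>abs_\<mu>\<close> absorb the undetermined sign of the volume equation.\<close>

locale warped_quadric = quadric_immersion \<phi> U G \<epsilon>
  for \<phi> :: "real ^ 'm::finite \<Rightarrow> real ^ 'n::finite" and U G \<epsilon> +
  fixes \<gamma>\<^sub>1 \<gamma>\<^sub>2 \<mu> \<nu> :: "real \<Rightarrow> real" and I :: "real set"
  assumes open_I: "open I"
    and smooth: "smooth_on I \<gamma>\<^sub>1" "smooth_on I \<gamma>\<^sub>2" "smooth_on I \<mu>" "smooth_on I \<nu>"
    and W_sign: "t \<in> I \<Longrightarrow> \<epsilon> * deriv \<gamma>\<^sub>2 t * \<gamma>\<^sub>1 t *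
      (deriv (deriv \<gamma>\<^sub>1) t * deriv \<gamma>\<^sub>2 t - deriv (deriv \<gamma>\<^sub>2) t * deriv \<gamma>\<^sub>1 t) < 0"
    and deriv_\<mu>: "t \<in> I \<Longrightarrow> deriv \<mu> t = - \<nu> t *
      ((deriv (deriv \<gamma>\<^sub>1) t * deriv \<gamma>\<^sub>2 t - deriv (deriv \<gamma>\<^sub>2) t * deriv \<gamma>\<^sub>1 t) / deriv \<gamma>\<^sub>2 t)"
    and abs_\<mu>: "t \<in> I \<Longrightarrow> \<bar>\<mu> t ^ (CARD('n) + 2) * \<gamma>\<^sub>1 t ^ (CARD('n) - 1) * deriv \<gamma>\<^sub>2 t ^ 3\<bar> =
      \<bar>deriv (deriv \<gamma>\<^sub>1) t * deriv \<gamma>\<^sub>2 t - deriv (deriv \<gamma>\<^sub>2) t * deriv \<gamma>\<^sub>1 t\<bar>"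
    and \<mu>_sign: "t \<in> I \<Longrightarrow> \<mu> t * deriv \<gamma>\<^sub>2 t *
      (deriv (deriv \<gamma>\<^sub>1) t * deriv \<gamma>\<^sub>2 t - deriv (deriv \<gamma>\<^sub>2) t * deriv \<gamma>\<^sub>1 t) > 0"
begin

abbreviation "\<gamma>\<^sub>1' \<equiv> deriv \<gamma>\<^sub>1"
abbreviation "\<gamma>\<^sub>2' \<equiv> deriv \<gamma>\<^sub>2"
abbreviation "W \<equiv> \<lambda>t. deriv \<gamma>\<^sub>1' t * \<gamma>\<^sub>2' t - deriv \<gamma>\<^sub>2' t * \<gamma>\<^sub>1' t"
abbreviation "M \<equiv> I \<times> U"

definition F :: "real \<times> (real ^ 'm) \<Rightarrow> (real ^ 'n) \<times> real" where
  "F p = (\<gamma>\<^sub>1 (fst p) *\<^sub>R \<phi> (snd p), \<gamma>\<^sub>2 (fst p))"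

definition \<xi> :: "real \<times> (real ^ 'm) \<Rightarrow> (real ^ 'n) \<times> real" where
  "\<xi> p = \<mu> (fst p) *\<^sub>R (\<phi> (snd p), 0) + \<nu> (fst p) *\<^sub>R (\<gamma>\<^sub>1' (fst p) *\<^sub>R \<phi> (snd p), \<gamma>\<^sub>2' (fst p))"

definition \<alpha> :: "real \<Rightarrow> real" where "\<alpha> t = W t / (\<gamma>\<^sub>2' t * \<mu> t)"
definition \<beta> :: "real \<Rightarrow> real" where "\<beta> t = - \<epsilon> * \<gamma>\<^sub>1 t / \<mu> t"

definition h :: "real \<times> (real ^ 'm) \<Rightarrow> real \<times> (real ^ 'm) \<Rightarrow> real \<times> (real ^ 'm) \<Rightarrow> real" where
  "h p x y = \<alpha> (fst p) * fst x * fst y + \<beta> (fst p) * quadric_metric (snd p) (snd x) (snd y)"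

text \<open>The Christoffel terms of \<open>\<alpha> dt^2 + \<beta> g\<close>, to be added to the
  flat derivative of the parameter space. The terms with \<open>deriv \<beta>\<close> reflect that
  the size of the quadric factor varies with t.\<close>

definition h_conn :: "real \<times> (real ^ 'm) \<Rightarrow> real \<times> (real ^ 'm) \<Rightarrow> real \<times> (real ^ 'm) \<Rightarrow> real \<times> (real ^ 'm)" where
  "h_conn p x y =
     (deriv \<alpha> (fst p) / (2 * \<alpha> (fst p)) * (fst x * fst y)
        - deriv \<beta> (fst p) / (2 * \<alpha> (fst p)) * quadric_metric (snd p) (snd x) (snd y),
      (deriv \<beta> (fst p) / (2 * \<beta> (fst p))) *\<^sub>R (fst x *\<^sub>R snd y + fst y *\<^sub>R snd x)
        + quadric_conn (snd p) (snd x) (snd y))"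

lemma open_M: "open M"
  by (intro open_Times open_I open_U)

lemma smooth_derivs: "smooth_on I \<gamma>\<^sub>1'" "smooth_on I \<gamma>\<^sub>2'" "smooth_on I (deriv \<gamma>\<^sub>1')" "smooth_on I (deriv \<gamma>\<^sub>2')"
  by (intro smooth_on_deriv open_I smooth)+

lemma nonzero:
  assumes "t \<in> I"
  shows "\<gamma>\<^sub>1 t \<noteq> 0" "\<gamma>\<^sub>2' t \<noteq> 0" "\<mu> t \<noteq> 0" "W t \<noteq> 0"
  using W_sign[OF assms] \<mu>_sign[OF assms] by auto

lemma \<alpha>_pos:
  assumes "t \<in> I"
  shows "\<alpha> t > 0"
proof -
  have "\<alpha> t = \<mu> t * \<gamma>\<^sub>2' t * W t / (\<gamma>\<^sub>2' t * \<mu> t)\<^sup>2"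
    using nonzero[OF assms] unfolding \<alpha>_def by (simp add: power2_eq_square)
  then show ?thesis
    using \<mu>_sign[OF assms] nonzero[OF assms] by simp
qed

text \<open>Up to division by a square, \<beta> is the product of the two quantities that
  \<open>W_sign\<close> and \<open>\<mu>_sign\<close> make positive.\<close>

lemma \<beta>_pos:
  assumes "t \<in> I"
  shows "\<beta> t > 0"
proof -
  have "\<beta> t = (- (\<epsilon> * \<gamma>\<^sub>2' t * \<gamma>\<^sub>1 t * W t)) * (\<mu> t * \<gamma>\<^sub>2' t * W t) / (\<gamma>\<^sub>2' t * W t * \<mu> t)\<^sup>2"
    using nonzero[OF assms] unfolding \<beta>_def by (simp add: power2_eq_square)
  moreover have "- (\<epsilon> * \<gamma>\<^sub>2' t * \<gamma>\<^sub>1 t * W t) > 0"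
    using W_sign[OF assms] by simp
  ultimately show ?thesis
    using \<mu>_sign[OF assms] nonzero[OF assms]
    by (metis divide_pos_pos mult_eq_0_iff mult_pos_pos zero_less_power2)
qed

lemma smooth_on_fst: "smooth_on I f \<Longrightarrow> smooth_on M (\<lambda>p. f (fst p))"
  by (rule smooth_on_compose_linear[OF bounded_linear_fst open_M]) auto

lemma smooth_on_\<phi>_snd: "smooth_on M (\<lambda>p. \<phi> (snd p))"
  by (rule smooth_on_compose_linear[OF bounded_linear_snd open_M _ smooth_\<phi>]) auto

lemma smooth_F: "smooth_on M F"
  unfolding F_def[abs_def]
  by (intro smooth_on_Pair smooth_on_scaleR smooth_on_fst smooth_on_\<phi>_snd open_M smooth)

lemma smooth_\<xi>: "smooth_on M \<xi>"
  unfolding \<xi>_def[abs_def]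
  by (intro smooth_on_add smooth_on_Pair smooth_on_scaleR smooth_on_fst smooth_on_\<phi>_snd smooth_on_const
      open_M smooth smooth_derivs)

lemma smooth_\<alpha>: "smooth_on I \<alpha>"
  unfolding \<alpha>_def[abs_def]
  by (intro smooth_on_divide smooth_on_diff smooth_on_mult smooth smooth_derivs open_I)
    (simp add: nonzero)

lemma smooth_\<beta>: "smooth_on I \<beta>"
  unfolding \<beta>_def[abs_def]
  by (intro smooth_on_divide smooth_on_mult smooth smooth_on_const open_I)
    (simp add: nonzero)

lemma fst_has_derivative:
  assumes "smooth_on I f" "p \<in> M"
  shows "((\<lambda>q. f (fst q)) has_derivative (\<lambda>x. fst x * deriv f (fst p))) (at p)"
proof -
  have "(f has_derivative (\<lambda>h. h * deriv f (fst p))) (at (fst p))"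
    using smooth_on_DERIV[OF assms(1)] assms(2) by (auto simp: has_field_derivative_def mult_commute_abs)
  from diff_chain_at[OF bounded_linear_imp_has_derivative[OF bounded_linear_fst] this]
  show ?thesis by (simp add: o_def)
qed

lemma snd_has_derivative:
  assumes "p \<in> M"
  shows "((\<lambda>q. \<phi> (snd q)) has_derivative (\<lambda>x. D\<phi> (snd p) (snd x))) (at p)"
proof -
  have "(\<phi> has_derivative D\<phi> (snd p)) (at (snd p))"
    using smooth_onD_has_derivative[OF smooth_\<phi>] assms by auto
  from diff_chain_at[OF bounded_linear_imp_has_derivative[OF bounded_linear_snd] this]
  show ?thesis by (simp add: o_def)
qed

lemma D\<phi>_snd_has_derivative:
  assumes "p \<in> M"
  shows "((\<lambda>q. D\<phi> (snd q) w) has_derivative (\<lambda>x. hess \<phi> (snd p) (snd x) w)) (at p)"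
proof -
  have "((\<lambda>u. D\<phi> u w) has_derivative (\<lambda>v. hess \<phi> (snd p) v w)) (at (snd p))"
    using hess_has_derivative[OF smooth_\<phi>] assms by auto
  from diff_chain_at[OF bounded_linear_imp_has_derivative[OF bounded_linear_snd] this]
  show ?thesis by (simp add: o_def)
qed

section \<open>Structure equations of the warped hypersurface\<close>

lemma frechet_F:
  assumes "p \<in> M"
  shows "frechet_derivative F (at p) x =
    ((fst x * \<gamma>\<^sub>1' (fst p)) *\<^sub>R \<phi> (snd p) + \<gamma>\<^sub>1 (fst p) *\<^sub>R D\<phi> (snd p) (snd x), fst x * \<gamma>\<^sub>2' (fst p))"
proof -
  have "(F has_derivative (\<lambda>x. (\<gamma>\<^sub>1 (fst p) *\<^sub>R D\<phi> (snd p) (snd x) + (fst x * \<gamma>\<^sub>1' (fst p)) *\<^sub>R \<phi> (snd p),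
      fst x * \<gamma>\<^sub>2' (fst p)))) (at p)"
    unfolding F_def[abs_def]
    by (intro has_derivative_Pair has_derivative_scaleR snd_has_derivative assms
        fst_has_derivative[OF smooth(1)] fst_has_derivative[OF smooth(2)])
  from frechet_derivative_at[OF this, symmetric] show ?thesis
    by (simp add: add.commute)
qed

lemma hess_F:
  assumes "p \<in> M"
  shows "hess F p x y =
    ((fst x * fst y * deriv \<gamma>\<^sub>1' (fst p)) *\<^sub>R \<phi> (snd p)
       + \<gamma>\<^sub>1' (fst p) *\<^sub>R (fst x *\<^sub>R D\<phi> (snd p) (snd y) + fst y *\<^sub>R D\<phi> (snd p) (snd x))
       + \<gamma>\<^sub>1 (fst p) *\<^sub>R hess \<phi> (snd p) (snd x) (snd y),
     fst x * fst y * deriv \<gamma>\<^sub>2' (fst p))"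
proof -
  note d = fst_has_derivative[OF smooth(1) assms] fst_has_derivative[OF smooth_derivs(1) assms]
    fst_has_derivative[OF smooth_derivs(2) assms] snd_has_derivative[OF assms] D\<phi>_snd_has_derivative[OF assms]
  have "((\<lambda>q. ((fst y * \<gamma>\<^sub>1' (fst q)) *\<^sub>R \<phi> (snd q) + \<gamma>\<^sub>1 (fst q) *\<^sub>R D\<phi> (snd q) (snd y), fst y * \<gamma>\<^sub>2' (fst q)))
    has_derivative (\<lambda>x. ((fst y * \<gamma>\<^sub>1' (fst p)) *\<^sub>R D\<phi> (snd p) (snd x)
        + (fst y * (fst x * deriv \<gamma>\<^sub>1' (fst p))) *\<^sub>R \<phi> (snd p)
        + (\<gamma>\<^sub>1 (fst p) *\<^sub>R hess \<phi> (snd p) (snd x) (snd y) + (fst x * \<gamma>\<^sub>1' (fst p)) *\<^sub>R D\<phi> (snd p) (snd y)),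
      fst y * (fst x * deriv \<gamma>\<^sub>2' (fst p))))) (at p)"
    by (intro has_derivative_Pair has_derivative_add has_derivative_scaleR has_derivative_mult_right d)
  then have "((\<lambda>q. frechet_derivative F (at q) y) has_derivative (\<lambda>x. ((fst y * \<gamma>\<^sub>1' (fst p)) *\<^sub>R D\<phi> (snd p) (snd x)
        + (fst y * (fst x * deriv \<gamma>\<^sub>1' (fst p))) *\<^sub>R \<phi> (snd p)
        + (\<gamma>\<^sub>1 (fst p) *\<^sub>R hess \<phi> (snd p) (snd x) (snd y) + (fst x * \<gamma>\<^sub>1' (fst p)) *\<^sub>R D\<phi> (snd p) (snd y)),
      fst y * (fst x * deriv \<gamma>\<^sub>2' (fst p))))) (at p)"
    by (rule has_derivative_transform_within_open[OF _ open_M assms]) (rule frechet_F[symmetric])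
  from frechet_derivative_at[OF this, symmetric] show ?thesis
    by (simp add: hess_def algebra_simps)
qed

lemma frechet_\<xi>:
  assumes "p \<in> M"
  shows "frechet_derivative \<xi> (at p) x = frechet_derivative F (at p)
    ((deriv \<nu> (fst p) + \<nu> (fst p) * deriv \<gamma>\<^sub>2' (fst p) / \<gamma>\<^sub>2' (fst p)) * fst x,
     ((\<mu> (fst p) + \<nu> (fst p) * \<gamma>\<^sub>1' (fst p)) / \<gamma>\<^sub>1 (fst p)) *\<^sub>R snd x)"
proof -
  obtain t u where p: "p = (t, u)" "t \<in> I" "u \<in> U" using assms by auto
  interpret D: linear "D\<phi> u" by (rule linear_D\<phi>[OF p(3)])
  note d = fst_has_derivative[OF smooth(3) assms] fst_has_derivative[OF smooth(4) assms]
    fst_has_derivative[OF smooth_derivs(1) assms] fst_has_derivative[OF smooth_derivs(2) assms]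
    snd_has_derivative[OF assms] has_derivative_const
  have "(\<xi> has_derivative (\<lambda>x.
      (\<mu> (fst p) *\<^sub>R (D\<phi> (snd p) (snd x), 0) + (fst x * deriv \<mu> (fst p)) *\<^sub>R (\<phi> (snd p), 0)) +
      (\<nu> (fst p) *\<^sub>R (\<gamma>\<^sub>1' (fst p) *\<^sub>R D\<phi> (snd p) (snd x) + (fst x * deriv \<gamma>\<^sub>1' (fst p)) *\<^sub>R \<phi> (snd p),
          fst x * deriv \<gamma>\<^sub>2' (fst p))
       + (fst x * deriv \<nu> (fst p)) *\<^sub>R (\<gamma>\<^sub>1' (fst p) *\<^sub>R \<phi> (snd p), \<gamma>\<^sub>2' (fst p))))) (at p)"
    unfolding \<xi>_def[abs_def]
    by (intro has_derivative_add has_derivative_scaleR has_derivative_Pair d)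
  note deriv = frechet_derivative_at[OF this, symmetric]
  \<comment> \<open>What would remain outside the tangent space is \<phi> times \<open>fst x *
    (deriv \<mu> t + \<nu> t * W t / \<gamma>\<^sub>2' t)\<close>; the equation for the derivative
    of \<mu> makes it vanish.\<close>
  have cancel: "fst x * deriv \<mu> t + fst x * \<nu> t * deriv \<gamma>\<^sub>1' t
      = fst x * \<nu> t * deriv \<gamma>\<^sub>2' t / \<gamma>\<^sub>2' t * \<gamma>\<^sub>1' t"
    using nonzero(2)[OF p(2)] by (simp add: deriv_\<mu>[OF p(2)] field_simps)
  have "(\<mu> t *\<^sub>R D\<phi> u (snd x) + (fst x * deriv \<mu> t) *\<^sub>R \<phi> u) +
      (\<nu> t *\<^sub>R (\<gamma>\<^sub>1' t *\<^sub>R D\<phi> u (snd x) + (fst x * deriv \<gamma>\<^sub>1' t) *\<^sub>R \<phi> u)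
       + (fst x * deriv \<nu> t) *\<^sub>R (\<gamma>\<^sub>1' t *\<^sub>R \<phi> u))
     = (fst x * deriv \<mu> t + fst x * \<nu> t * deriv \<gamma>\<^sub>1' t + fst x * deriv \<nu> t * \<gamma>\<^sub>1' t) *\<^sub>R \<phi> u
       + (\<mu> t + \<nu> t * \<gamma>\<^sub>1' t) *\<^sub>R D\<phi> u (snd x)"
    by (simp add: algebra_simps)
  also have "\<dots> = ((deriv \<nu> t + \<nu> t * deriv \<gamma>\<^sub>2' t / \<gamma>\<^sub>2' t) * fst x * \<gamma>\<^sub>1' t) *\<^sub>R \<phi> u
       + \<gamma>\<^sub>1 t *\<^sub>R D\<phi> u (((\<mu> t + \<nu> t * \<gamma>\<^sub>1' t) / \<gamma>\<^sub>1 t) *\<^sub>R snd x)"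
    unfolding cancel using nonzero[OF p(2)] by (simp add: D.scaleR) (simp add: algebra_simps)
  finally show ?thesis
    unfolding deriv frechet_F[OF assms] using nonzero[OF p(2)] by (simp add: p(1) field_simps)
qed

lemma inj_F:
  assumes "p \<in> M"
  shows "inj (frechet_derivative F (at p))"
proof -
  obtain t u where p: "p = (t, u)" "t \<in> I" "u \<in> U" using assms by auto
  show ?thesis
  proof (rule injI)
    fix x y assume "frechet_derivative F (at p) x = frechet_derivative F (at p) y"
    then have "fst x = fst y" "D\<phi> u (snd x) = D\<phi> u (snd y)"
      using nonzero[OF p(2)] by (auto simp: frechet_F[OF assms, unfolded p(1)] p(1))
    then show "x = y"
      using inj_D\<phi>[OF p(3)] by (auto simp: prod_eq_iff dest: injD)
  qed
qed

lemma immersion_F: "immersion_on M F"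
  unfolding immersion_on_def using smooth_F inj_F by blast

text \<open>Comparing last coordinates removes the multiple of \<open>\<partial>\<^sub>t\<close>;
  then \<open>\<mu> \<phi>\<close> would be tangent to the quadric, which pairing with \<phi> under
  \<open>Q\<close> excludes.\<close>

lemma transversal_\<xi>: "transversal_on M F \<xi>"
  unfolding transversal_on_def
proof (intro ballI notI)
  fix p assume pM: "p \<in> M" and "\<xi> p \<in> range (frechet_derivative F (at p))"
  then obtain x where x: "\<xi> p = frechet_derivative F (at p) x" by auto
  obtain t u where p: "p = (t, u)" "t \<in> I" "u \<in> U" using pM by auto
  have "fst x = \<nu> t"
    using x nonzero(2)[OF p(2)] by (simp add: \<xi>_def frechet_F[OF pM, unfolded p(1)] p(1))
  then have "\<mu> t *\<^sub>R \<phi> u = \<gamma>\<^sub>1 t *\<^sub>R D\<phi> u (snd x)"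
    using x by (simp add: \<xi>_def frechet_F[OF pM, unfolded p(1)] p(1) algebra_simps)
  then have "Q (\<phi> u) (\<mu> t *\<^sub>R \<phi> u) = Q (\<phi> u) (\<gamma>\<^sub>1 t *\<^sub>R D\<phi> u (snd x))" by simp
  then have "\<mu> t * \<epsilon> = 0"
    by (simp add: Q_\<phi>_\<phi>[OF p(3)] Q_\<phi>_D\<phi>[OF p(3)])
  then show False using nonzero(3)[OF p(2)] eps_nz by simp
qed

text \<open>The last coordinate fixes the coefficient of \<open>\<partial>\<^sub>t\<close> in terms
  of h, and the remaining multiple of \<phi> must be h times \<mu>. This balance is the origin of
  \<alpha> and \<beta>, and in it \<nu> cancels.\<close>

lemma hess_F_decomposition:
  assumes "p \<in> M"
  shows "hess F p x y = frechet_derivative F (at p)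
     (fst x * fst y * deriv \<gamma>\<^sub>2' (fst p) / \<gamma>\<^sub>2' (fst p) - \<nu> (fst p) * h p x y,
      (\<gamma>\<^sub>1' (fst p) / \<gamma>\<^sub>1 (fst p)) *\<^sub>R (fst x *\<^sub>R snd y + fst y *\<^sub>R snd x) + quadric_conn (snd p) (snd x) (snd y))
     + h p x y *\<^sub>R \<xi> p"
proof -
  obtain t u where p: "p = (t, u)" "t \<in> I" "u \<in> U" using assms by auto
  interpret D: linear "D\<phi> u" by (rule linear_D\<phi>[OF p(3)])
  define H where "H = h p x y"
  have H: "H * \<mu> t = fst x * fst y * W t / \<gamma>\<^sub>2' t - \<epsilon> * \<gamma>\<^sub>1 t * quadric_metric u (snd x) (snd y)"
    using nonzero[OF p(2)] by (simp add: H_def h_def p(1) \<alpha>_def \<beta>_def field_simps)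
  have coeff: "fst x * fst y * deriv \<gamma>\<^sub>1' t - \<epsilon> * \<gamma>\<^sub>1 t * quadric_metric u (snd x) (snd y)
      = (fst x * fst y * deriv \<gamma>\<^sub>2' t / \<gamma>\<^sub>2' t - \<nu> t * H) * \<gamma>\<^sub>1' t + H * \<mu> t + H * \<nu> t * \<gamma>\<^sub>1' t"
    unfolding H using nonzero(2)[OF p(2)] by (simp add: field_simps)
  have "(fst x * fst y * deriv \<gamma>\<^sub>1' t) *\<^sub>R \<phi> u
       + \<gamma>\<^sub>1' t *\<^sub>R (fst x *\<^sub>R D\<phi> u (snd y) + fst y *\<^sub>R D\<phi> u (snd x))
       + \<gamma>\<^sub>1 t *\<^sub>R hess \<phi> u (snd x) (snd y)
     = (fst x * fst y * deriv \<gamma>\<^sub>1' t - \<epsilon> * \<gamma>\<^sub>1 t * quadric_metric u (snd x) (snd y)) *\<^sub>R \<phi> u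
       + \<gamma>\<^sub>1' t *\<^sub>R (fst x *\<^sub>R D\<phi> u (snd y) + fst y *\<^sub>R D\<phi> u (snd x))
       + \<gamma>\<^sub>1 t *\<^sub>R D\<phi> u (quadric_conn u (snd x) (snd y))"
    by (simp add: hess_\<phi>[OF p(3)] algebra_simps)
  also have "\<dots> = ((fst x * fst y * deriv \<gamma>\<^sub>2' t / \<gamma>\<^sub>2' t - \<nu> t * H) * \<gamma>\<^sub>1' t) *\<^sub>R \<phi> u
       + \<gamma>\<^sub>1 t *\<^sub>R D\<phi> u ((\<gamma>\<^sub>1' t / \<gamma>\<^sub>1 t) *\<^sub>R (fst x *\<^sub>R snd y + fst y *\<^sub>R snd x) + quadric_conn u (snd x) (snd y))
       + H *\<^sub>R (\<mu> t *\<^sub>R \<phi> u + (\<nu> t * \<gamma>\<^sub>1' t) *\<^sub>R \<phi> u)"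
    unfolding coeff using nonzero(1)[OF p(2)]
    by (simp add: D.add D.scaleR scaleR_add_left scaleR_add_right)
  finally show ?thesis
    unfolding hess_F[OF assms] frechet_F[OF assms] H_def[symmetric] \<xi>_def
    using nonzero(2)[OF p(2)] by (simp add: p(1)) (simp add: field_simps)
qed

lemma decomposition_eqs:
  assumes "p \<in> M"
  shows "tangential F \<xi> p (frechet_derivative F (at p) z + c *\<^sub>R \<xi> p) = z"
    and "transverse F \<xi> p (frechet_derivative F (at p) z + c *\<^sub>R \<xi> p) = c"
  using tangential_eq[of F p \<xi>, OF linear_frechet[OF smooth_F assms] inj_F[OF assms]]
    transverse_eq[of F p \<xi>, OF linear_frechet[OF smooth_F assms] inj_F[OF assms]]
    transversal_\<xi> assms unfolding transversal_on_def by blast+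

lemma affine_metric_eq:
  assumes "p \<in> M"
  shows "affine_metric F \<xi> p = h p"
  by (intro ext)
    (simp only: affine_metric_def flat_deriv_const hess_F_decomposition[OF assms] decomposition_eqs[OF assms])

lemma induced_conn_eq:
  assumes "p \<in> M"
  shows "induced_conn F \<xi> (\<lambda>_. x) (\<lambda>_. y) p =
     (fst x * fst y * deriv \<gamma>\<^sub>2' (fst p) / \<gamma>\<^sub>2' (fst p) - \<nu> (fst p) * h p x y,
      (\<gamma>\<^sub>1' (fst p) / \<gamma>\<^sub>1 (fst p)) *\<^sub>R (fst x *\<^sub>R snd y + fst y *\<^sub>R snd x) + quadric_conn (snd p) (snd x) (snd y))"
  by (simp only: induced_conn_def flat_deriv_const hess_F_decomposition[OF assms] decomposition_eqs[OF assms])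

lemma shape_op_eq:
  assumes "p \<in> M"
  shows "shape_op F \<xi> p x =
    - ((deriv \<nu> (fst p) + \<nu> (fst p) * deriv \<gamma>\<^sub>2' (fst p) / \<gamma>\<^sub>2' (fst p)) * fst x,
       ((\<mu> (fst p) + \<nu> (fst p) * \<gamma>\<^sub>1' (fst p)) / \<gamma>\<^sub>1 (fst p)) *\<^sub>R snd x)"
  unfolding shape_op_def frechet_\<xi>[OF assms] using decomposition_eqs(1)[OF assms, of _ 0] by simp

section \<open>The warped metric and its Levi-Civita connection\<close>

lemma h_sym: "h p x y = h p y x"
  by (simp add: h_def quadric_metric_sym mult_ac)

lemma linear_h:
  assumes "p \<in> M"
  shows "linear (h p x)" and "linear (\<lambda>y. h p y x)"
proof -
  interpret g: linear "quadric_metric (snd p) (snd x)" using linear_quadric_metric assms by auto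
  show "linear (h p x)"
    by (rule linearI) (simp_all add: h_def g.add g.scaleR algebra_simps)
  then show "linear (\<lambda>y. h p y x)" by (simp add: h_sym[of p _ x])
qed

lemma h_positive_definite:
  assumes "p \<in> M"
  shows "positive_definite (h p)"
  unfolding positive_definite_def
proof (intro allI impI)
  fix x :: "real \<times> (real ^ 'm)" assume "x \<noteq> 0"
  obtain t u where p: "p = (t, u)" "t \<in> I" "u \<in> U" using assms by auto
  interpret g: linear "quadric_metric u 0" using linear_quadric_metric p(3) by auto
  have a: "\<alpha> t * (fst x * fst x) \<ge> 0" "fst x \<noteq> 0 \<Longrightarrow> \<alpha> t * (fst x * fst x) > 0"
    using \<alpha>_pos[OF p(2)] by (auto simp: zero_less_mult_iff not_less)
  have b: "\<beta> t * quadric_metric u (snd x) (snd x) > 0" if "snd x \<noteq> 0"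
    using \<beta>_pos[OF p(2)] quadric_metric_pos[OF p(3) that] by simp
  have "quadric_metric u (snd x) (snd x) = 0" if "snd x = 0"
    using that g.zero by simp
  then have "h p x x > 0" using a b \<open>x \<noteq> 0\<close>
    by (cases "snd x = 0"; cases "fst x = 0") (auto simp: h_def p(1) prod_eq_iff mult.assoc intro: add_pos_pos)
  then show "0 < h p x x" .
qed

lemma h_nondegenerate:
  assumes "p \<in> M"
  shows "nondegenerate_form (h p)"
  using h_positive_definite[OF assms] unfolding nondegenerate_form_def positive_definite_def
  by (metis less_irrefl)

text \<open>A flat derivative plus a symmetric bilinear term is always a torsion-free connection, so
  only compatibility with h has content; there the derivatives of \<alpha> and \<beta> meet the
  compatibility of \<open>quadric_conn\<close> with its metric.\<close>

lemma is_levi_civita_h: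
  "is_levi_civita M (affine_metric F \<xi>) (\<lambda>X Y p. frechet_derivative Y (at p) (X p) + h_conn p (X p) (Y p))"
  unfolding is_levi_civita_def
proof (intro allI impI ballI, goal_cases)
  case (1 X Y Z f p)
  note XYZ = 1(1-3) and f = 1(4) and pM = 1(5)
  obtain t u where p: "p = (t, u)" "t \<in> I" "u \<in> U" using pM by auto
  note d = smooth_onD_has_derivative[OF XYZ(1) pM] smooth_onD_has_derivative[OF XYZ(2) pM]
    smooth_onD_has_derivative[OF XYZ(3) pM] smooth_onD_has_derivative[OF f pM]
  have lin: "linear (frechet_derivative X (at p))" "linear (frechet_derivative Y (at p))"
    "linear (frechet_derivative Z (at p))"
    using d has_derivative_linear by blast+
  have glin: "linear (quadric_metric u v)" "linear (quadric_conn u v)" for v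
    using linear_quadric_metric[OF p(3)] linear_quadric_conn[OF p(3)] by auto
  have conn_sym: "h_conn p x y = h_conn p y x" for x y
    by (simp add: h_conn_def p(1) quadric_metric_sym[of u "snd x"] quadric_conn_sym[OF p(3), of "snd x"]
        add.commute mult.commute)
  have "linear (h_conn p x)" for x
    by (rule linearI) (simp_all add: h_conn_def p(1) linear_add[OF glin(1)] linear_add[OF glin(2)]
        linear_cmul[OF glin(1)] linear_cmul[OF glin(2)] algebra_simps add_divide_distrib)
  note conn_right = linear_add[OF this] linear_cmul[OF this]
  have conn_left: "h_conn p (x + y) z = h_conn p x z + h_conn p y z"
      "h_conn p (c *\<^sub>R x) z = c *\<^sub>R h_conn p x z" for x y z c
    by (simp_all add: conn_sym[of _ z] conn_right)
  have sum: "frechet_derivative (\<lambda>q. Y q + Z q) (at p) v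
      = frechet_derivative Y (at p) v + frechet_derivative Z (at p) v" for v
    by (rule fun_cong[OF frechet_derivative_at[OF has_derivative_add[OF d(2,3)], symmetric]])
  have prod: "frechet_derivative (\<lambda>q. f q *\<^sub>R Y q) (at p) v
      = f p *\<^sub>R frechet_derivative Y (at p) v + frechet_derivative f (at p) v *\<^sub>R Y p" for v
    by (rule fun_cong[OF frechet_derivative_at[OF has_derivative_scaleR[OF d(4,2)], symmetric]])
  define dY where "dY = frechet_derivative Y (at p) (X p)"
  define dZ where "dZ = frechet_derivative Z (at p) (X p)"
  have metric: "frechet_derivative (\<lambda>q. affine_metric F \<xi> q (Y q) (Z q)) (at p) (X p)
      = h p (dY + h_conn p (X p) (Y p)) (Z p) + h p (Y p) (dZ + h_conn p (X p) (Z p))"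
  proof -
    have "((\<lambda>q. quadric_metric (snd q) (snd (Y q)) (snd (Z q))) has_derivative
      (\<lambda>x. quadric_metric (snd p) (snd (frechet_derivative Y (at p) x) + quadric_conn (snd p) (snd x) (snd (Y p))) (snd (Z p))
       + quadric_metric (snd p) (snd (Y p)) (snd (frechet_derivative Z (at p) x) + quadric_conn (snd p) (snd x) (snd (Z p))))) (at p)"
      using p d by (intro quadric_metric_along_has_derivative bounded_linear_imp_has_derivative
          bounded_linear_snd has_derivative_snd) auto
    then have "((\<lambda>q. h q (Y q) (Z q)) has_derivative (\<lambda>x.
       (\<alpha> (fst p) * fst (Y p) * fst (frechet_derivative Z (at p) x)
        + (\<alpha> (fst p) * fst (frechet_derivative Y (at p) x) + (fst x * deriv \<alpha> (fst p)) * fst (Y p)) * fst (Z p))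
       + (\<beta> (fst p) * (quadric_metric (snd p) (snd (frechet_derivative Y (at p) x) + quadric_conn (snd p) (snd x) (snd (Y p))) (snd (Z p))
            + quadric_metric (snd p) (snd (Y p)) (snd (frechet_derivative Z (at p) x) + quadric_conn (snd p) (snd x) (snd (Z p))))
          + (fst x * deriv \<beta> (fst p)) * quadric_metric (snd p) (snd (Y p)) (snd (Z p))))) (at p)"
      (is "(_ has_derivative ?D) _")
      unfolding h_def
      by (intro has_derivative_add has_derivative_mult fst_has_derivative[OF smooth_\<alpha> pM]
          fst_has_derivative[OF smooth_\<beta> pM] has_derivative_fst d)
    then have "((\<lambda>q. affine_metric F \<xi> q (Y q) (Z q)) has_derivative ?D) (at p)"
      by (rule has_derivative_transform_within_open[OF _ open_M pM]) (simp add: affine_metric_eq)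
    note deriv = frechet_derivative_at[OF this, symmetric]
    have glin_left: "linear (\<lambda>x. quadric_metric u x v)" for v
      using glin(1)[of v] by (simp add: quadric_metric_sym[of u _ v])
    have nz: "\<alpha> t \<noteq> 0" "\<beta> t \<noteq> 0"
      using \<alpha>_pos[OF p(2)] \<beta>_pos[OF p(2)] by auto
    show ?thesis
      unfolding deriv dY_def[symmetric] dZ_def[symmetric]
      using nz by (simp add: h_def h_conn_def p(1) linear_add[OF glin(1)] linear_cmul[OF glin(1)]
          linear_add[OF glin_left] linear_cmul[OF glin_left]
          quadric_metric_sym[of u "snd (Y (t, u))" "snd (X (t, u))"] field_simps)
  qed
  show ?case
    using metric unfolding dY_def dZ_def
    by (simp add: affine_metric_eq[OF pM] conn_left conn_right sum prod linear_add[OF lin(3)] linear_cmul[OF lin(3)]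
        conn_sym[of "Y p" "X p"] scaleR_add_right)
qed

section \<open>The difference tensor and the pointwise symmetry\<close>

lemma difference_tensor_eq:
  assumes "p \<in> M"
  shows "difference_tensor M F \<xi> p x y = induced_conn F \<xi> (\<lambda>_. x) (\<lambda>_. y) p - h_conn p x y"
proof -
  have "levi_civita M (affine_metric F \<xi>) (\<lambda>_. x) (\<lambda>_. y) p
      = frechet_derivative (\<lambda>_. y) (at p) x + h_conn p x y"
    by (rule levi_civita_const_eq[OF is_levi_civita_h assms])
      (simp_all add: affine_metric_eq[OF assms] h_sym linear_h[OF assms] h_nondegenerate[OF assms])
  then show ?thesis
    by (simp add: difference_tensor_def)
qed

lemma pointwise_SO_symmetric_F: "pointwise_SO_symmetric M F \<xi>"
  unfolding pointwise_SO_symmetric_def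
proof (intro ballI)
  fix p assume pM: "p \<in> M"
  obtain t u where p: "p = (t, u)" "t \<in> I" "u \<in> U" using pM by auto
  have \<alpha>: "\<alpha> t > 0" and \<beta>: "\<beta> t > 0" using \<alpha>_pos \<beta>_pos p(2) by auto
  have glin: "linear (quadric_metric u v)" "linear (\<lambda>x. quadric_metric u x v)" for v
    using linear_quadric_metric[OF p(3), of v] by (simp_all add: quadric_metric_sym[of u _ v])
  \<comment> \<open>\<open>\<partial>\<^sub>t\<close> has h-length \<open>sqrt (\<alpha> t)\<close>;
    its unit multiple is the fixed direction.\<close>
  let ?r = "1 / sqrt (\<alpha> t)"
  let ?x = "(?r, 0) :: real \<times> (real ^ 'm)"
  have "h p ?x ?x = 1"
    using \<alpha> linear_0[OF glin(1)] by (simp add: h_def p(1) field_simps)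
  moreover have "shape_op F \<xi> p (g v) = g (shape_op F \<xi> p v) \<and>
      difference_tensor M F \<xi> p (g v) (g w) = g (difference_tensor M F \<xi> p v w)"
    if g: "linear g" "g ?x = ?x" "restricts_to_SO (h p) ?x g" for g v w
  proof -
    obtain R where R: "linear R" "\<And>x. g x = (fst x, R (snd x))"
        "\<And>v w. quadric_metric u (R v) (R w) = quadric_metric u v w"
    proof (rule restricts_to_SO_isometry[OF glin _ _ _ _ g])
      show "h p x y = \<alpha> t * fst x * fst y + \<beta> t * quadric_metric u (snd x) (snd y)" for x y
        by (simp add: h_def p(1))
    qed (use \<alpha> \<beta> in auto)
    interpret R: linear R by (rule R(1))
    have hg: "h p (g v) (g w) = h p v w"
      by (simp add: h_def p(1) R(2,3))
    have "shape_op F \<xi> p (g v) = g (shape_op F \<xi> p v)"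
      by (simp add: shape_op_eq[OF pM] R(2) R.neg R.scaleR)
    \<comment> \<open>\<open>R\<close> need not preserve \<open>quadric_conn\<close>, so both
      connections are unfolded together and these terms cancel on either side.\<close>
    moreover have "difference_tensor M F \<xi> p (g v) (g w) = g (difference_tensor M F \<xi> p v w)"
      unfolding difference_tensor_eq[OF pM] induced_conn_eq[OF pM] h_conn_def hg
      by (simp add: p(1) R(2,3) R.add R.diff R.scaleR)
    ultimately show ?thesis ..
  qed
  ultimately show "\<exists>x. affine_metric F \<xi> p x x = 1 \<and>
      (\<forall>g. linear g \<and> bij g \<and> g x = x \<and> restricts_to_SO (affine_metric F \<xi> p) x g \<longrightarrow>
        (\<forall>v w. shape_op F \<xi> p (g v) = g (shape_op F \<xi> p v) \<and>
          difference_tensor M F \<xi> p (g v) (g w) = g (difference_tensor M F \<xi> p v w)))"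
    unfolding affine_metric_eq[OF pM] by blast
qed

section \<open>Convexity and the affine normal\<close>

lemma convex_hypersurface_F: "convex_hypersurface M F"
  unfolding convex_hypersurface_def
  using immersion_F smooth_\<xi> transversal_\<xi> h_positive_definite affine_metric_eq by metis

lemma equiaffine_\<xi>: "equiaffine_on M F \<xi>"
proof (rule equiaffine_onI[OF open_M _ immersion_F smooth_\<xi> transversal_\<xi>])
  show "DIM(real \<times> (real ^ 'm)) \<le> CARD('n)"
    by (simp add: card_n)
  show "frechet_derivative \<xi> (at p) v \<in> range (frechet_derivative F (at p))" if "p \<in> M" for p v
    unfolding frechet_\<xi>[OF that] by simp
  show "\<exists>z c. hess F p v w = frechet_derivative F (at p) z + c *\<^sub>R \<xi> p" if "p \<in> M" for p v w
    using hess_F_decomposition[OF that] by blast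
qed

text \<open>The Gram matrix of the frame \<open>\<partial>\<^sub>t, \<partial>\<^sub>1, \<dots>, \<xi>\<close>, after subtracting multiples of \<open>\<partial>\<^sub>t\<close> and \<open>\<xi>\<close> from
  one another, is block diagonal with respect to the form \<open>Q + ds\<^sup>2\<close>, and differs from the matrix of
  \<open>h\<close> only by scaling the rows.\<close>

lemma volume_condition:
  assumes "p \<in> M"
  shows "(induced_vol F \<xi> p V)\<^sup>2 = \<bar>det (\<chi> i j. h p (V i) (V j))\<bar>"
proof -
  obtain t u where p: "p = (t, u)" "t \<in> I" "u \<in> U" using assms by auto
  note nz = nonzero[OF p(2)]
  interpret D: linear "D\<phi> u" by (rule linear_D\<phi>[OF p(3)])
  \<comment> \<open>The frame is indexed by \<open>'n\<close>, while the parameter space offers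
    \<open>None\<close> for t and \<open>'m\<close> for the quadric. Only the cardinalities match,
    so some bijection is fixed.\<close>
  have "card (UNIV :: 'n set) = card (UNIV :: 'm option set)"
    by (simp add: card_n)
  then obtain \<tau> :: "'n \<Rightarrow> 'm option" where \<tau>: "bij_betw \<tau> UNIV UNIV"
    using finite_same_card_bij[of "UNIV :: 'n set" "UNIV :: 'm option set"] by auto
  define k0 where "k0 = inv \<tau> None"
  have \<tau>k0: "\<tau> k0 = None"
    using \<tau> unfolding k0_def by (metis bij_inv_eq_iff)
  have \<tau>None: "\<tau> k = None \<longleftrightarrow> k = k0" for k
    using \<tau> \<tau>k0 by (metis bij_betw_imp_inj_on injD)
  define e :: "'n \<Rightarrow> real \<times> (real ^ 'm)"
    where "e k = (case \<tau> k of None \<Rightarrow> (1, 0) | Some j \<Rightarrow> (0, axis j 1))" for k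
  define P where "P a = (case a of Some i \<Rightarrow> frechet_derivative F (at p) (e i) | None \<Rightarrow> \<xi> p)" for a
  define P' :: "'n option \<Rightarrow> (real ^ 'n) \<times> real" where "P' a = (case a of None \<Rightarrow> (\<mu> t *\<^sub>R \<phi> u, 0)
    | Some k \<Rightarrow> (case \<tau> k of None \<Rightarrow> (0, \<gamma>\<^sub>2' t) | Some j \<Rightarrow> (\<gamma>\<^sub>1 t *\<^sub>R D\<phi> u (axis j 1), 0)))" for a
  \<comment> \<open>Row factors that turn the Gram matrix of \<open>P'\<close> into the matrix of h
    bordered by 1: they send \<open>\<mu>^2 \<epsilon>\<close>, \<open>(\<gamma>\<^sub>2')^2\<close>
    and \<open>\<gamma>\<^sub>1^2 g\<close> to 1, \<alpha> and \<open>\<beta> g\<close>.\<close>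
  define c where "c a = (case a of None \<Rightarrow> 1 / ((\<mu> t)\<^sup>2 * \<epsilon>)
    | Some k \<Rightarrow> (case \<tau> k of None \<Rightarrow> \<alpha> t / (\<gamma>\<^sub>2' t)\<^sup>2 | Some j \<Rightarrow> \<beta> t / (\<gamma>\<^sub>1 t)\<^sup>2))" for a
  have Pk0: "P (Some k0) = (\<gamma>\<^sub>1' t *\<^sub>R \<phi> u, \<gamma>\<^sub>2' t)"
    by (simp add: P_def e_def \<tau>k0 frechet_F[OF assms] D.zero) (simp add: p(1) D.zero)
  define P1 where "P1 = P(None := P None + (- \<nu> t) *\<^sub>R P (Some k0))"
  have P1None: "P1 None = (\<mu> t *\<^sub>R \<phi> u, 0)"
    by (simp add: P1_def Pk0) (simp add: P_def \<xi>_def p(1))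
  have P2: "P' = P1(Some k0 := P1 (Some k0) + (- (\<gamma>\<^sub>1' t / \<mu> t)) *\<^sub>R P1 None)"
  proof
    fix a show "P' a = (P1(Some k0 := P1 (Some k0) + (- (\<gamma>\<^sub>1' t / \<mu> t)) *\<^sub>R P1 None)) a"
    proof (cases a)
      case None
      then show ?thesis using P1None by (simp add: P'_def)
    next
      case (Some k)
      show ?thesis
      proof (cases "k = k0")
        case True
        have "P1 (Some k0) = (\<gamma>\<^sub>1' t *\<^sub>R \<phi> u, \<gamma>\<^sub>2' t)"
          by (simp add: P1_def Pk0)
        then show ?thesis
          using Some True nz by (simp add: P'_def \<tau>k0 P1None)
      next
        case False
        then obtain j where "\<tau> k = Some j" using \<tau>None by fastforce
        then show ?thesis
          using Some False by (simp add: P'_def P1_def P_def e_def frechet_F[OF assms, unfolded p(1)] p(1))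
      qed
    qed
  qed
  have detP: "ambient_det P' = ambient_det P"
    unfolding P2 by (subst ambient_det_add_multiple, simp, unfold P1_def, rule ambient_det_add_multiple) simp
  have "induced_vol F \<xi> p e = ambient_det P"
    unfolding induced_vol_def P_def by simp
  moreover have "(ambient_det P')\<^sup>2 = \<bar>det (\<chi> i j. h p (e i) (e j))\<bar>"
  proof -
    define Gr :: "real ^ 'n option ^ 'n option"
      where "Gr = (\<chi> a b. fst (P' a) \<bullet> (G *v fst (P' b)) + snd (P' a) * snd (P' b))"
    have Gr: "Gr $ a $ b = Q (fst (P' a)) (fst (P' b)) + snd (P' a) * snd (P' b)" for a b
      by (simp add: Gr_def Q_def)
    define H :: "real ^ 'n option ^ 'n option" where "H = (\<chi> a. c a *s Gr $ a)"
    have Q_zero: "Q (\<phi> u) (D\<phi> u v) = 0" "Q (D\<phi> u v) (\<phi> u) = 0" for v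
      using Q_\<phi>_D\<phi>[OF p(3)] Q_sym by metis+
    have H_None: "H $ None $ b = (if b = None then 1 else 0)" for b
      using nz eps_nz by (simp add: H_def Gr c_def P'_def Q_\<phi>_\<phi>[OF p(3)] Q_zero power2_eq_square
          split: option.splits)
    have g0: "quadric_metric u 0 v = 0" "quadric_metric u v 0 = 0" for v
      by (simp_all add: quadric_metric_def D.zero)
    have H_Some: "H $ Some i $ Some j = h p (e i) (e j)" for i j
      using nz by (simp add: H_def Gr c_def P'_def e_def h_def p(1) g0 quadric_metric_def power2_eq_square
          split: option.splits)
    have det_h: "det H = det (\<chi> i j. h p (e i) (e j))"
      by (simp add: det_option_unit_row[OF H_None] H_Some)
    have det_H: "det H = prod c UNIV * ((ambient_det P')\<^sup>2 * det G)"
    proof -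
      have "det H = prod c UNIV * det (\<chi> a. Gr $ a)"
        unfolding H_def by (rule det_rows_mul)
      then show ?thesis
        by (simp add: ambient_det_gram Gr_def)
    qed
    \<comment> \<open>The volume equation in disguise: with \<open>m = CARD('m)\<close> the product
      is \<open>\<alpha> \<beta>^m / (\<epsilon> \<mu>^2 (\<gamma>\<^sub>2')^2
      \<gamma>\<^sub>1^(2m))\<close>. Since \<open>CARD('n) = m + 1\<close>, the exponents n + 2 and
      n - 1 appear as m + 3 and m.\<close>
    have prod_c: "\<bar>prod c UNIV\<bar> = 1"
    proof -
      define C where "C b = (case b of None \<Rightarrow> \<alpha> t / (\<gamma>\<^sub>2' t)\<^sup>2 | Some j \<Rightarrow> \<beta> t / (\<gamma>\<^sub>1 t)\<^sup>2)" for b :: "'m option"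
      have "prod c UNIV = 1 / ((\<mu> t)\<^sup>2 * \<epsilon>) * (\<Prod>k\<in>UNIV. C (\<tau> k))"
        by (simp add: prod_UNIV_option c_def C_def)
      also have "(\<Prod>k\<in>UNIV. C (\<tau> k)) = prod C UNIV"
        by (rule prod.reindex_bij_betw[OF \<tau>])
      also have "\<dots> = \<alpha> t / (\<gamma>\<^sub>2' t)\<^sup>2 * (\<beta> t / (\<gamma>\<^sub>1 t)\<^sup>2) ^ CARD('m)"
        by (simp add: prod_UNIV_option C_def)
      finally have "\<bar>prod c UNIV\<bar> = 1 / (\<bar>\<mu> t\<bar>\<^sup>2 * \<bar>\<epsilon>\<bar>) *
          (\<bar>\<alpha> t\<bar> / \<bar>\<gamma>\<^sub>2' t\<bar>\<^sup>2 * (\<bar>\<beta> t\<bar> / \<bar>\<gamma>\<^sub>1 t\<bar>\<^sup>2) ^ CARD('m))"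
        by (simp add: abs_mult power_abs)
      moreover have "\<bar>\<epsilon>\<bar> = 1" using eps by auto
      moreover have "\<bar>\<alpha> t\<bar> = \<bar>\<mu> t\<bar> ^ 2 * \<bar>\<gamma>\<^sub>2' t\<bar> ^ 2 * (\<bar>\<mu> t\<bar> * \<bar>\<gamma>\<^sub>1 t\<bar>) ^ CARD('m)"
      proof -
        have "\<bar>\<alpha> t\<bar> = \<bar>W t\<bar> / (\<bar>\<gamma>\<^sub>2' t\<bar> * \<bar>\<mu> t\<bar>)"
          by (simp add: \<alpha>_def abs_mult)
        also have "\<bar>W t\<bar> = \<bar>\<mu> t\<bar> ^ (CARD('m) + 3) * \<bar>\<gamma>\<^sub>1 t\<bar> ^ CARD('m) * \<bar>\<gamma>\<^sub>2' t\<bar> ^ 3"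
          using abs_\<mu>[OF p(2)] by (simp add: card_n abs_mult power_abs numeral_eq_Suc)
        finally show ?thesis
          using nz by (simp add: power_add power_mult_distrib numeral_eq_Suc)
      qed
      moreover have "\<bar>\<beta> t\<bar> = \<bar>\<gamma>\<^sub>1 t\<bar> / \<bar>\<mu> t\<bar>"
        using \<open>\<bar>\<epsilon>\<bar> = 1\<close> by (simp add: \<beta>_def abs_mult)
      moreover have "(\<bar>\<mu> t\<bar> * \<bar>\<gamma>\<^sub>1 t\<bar>) ^ CARD('m) * (\<bar>\<gamma>\<^sub>1 t\<bar> / \<bar>\<mu> t\<bar> / \<bar>\<gamma>\<^sub>1 t\<bar>\<^sup>2) ^ CARD('m) = 1"
        unfolding power_mult_distrib[symmetric] using nz by (simp add: power2_eq_square)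
      ultimately show ?thesis
        using nz by simp
    qed
    show ?thesis
      unfolding det_h[symmetric] det_H abs_mult prod_c det_G by simp
  qed
  ultimately have frame: "(induced_vol F \<xi> p e)\<^sup>2 = \<bar>det (\<chi> i j. h p (e i) (e j))\<bar>"
    by (simp add: detP)
  have spans: "\<exists>b. v = (\<Sum>k\<in>UNIV. b k *\<^sub>R e k)" for v
  proof -
    define b :: "'m option \<Rightarrow> real \<times> (real ^ 'm)" where "b d = (case d of None \<Rightarrow> fst v *\<^sub>R (1, 0)
      | Some j \<Rightarrow> (snd v $ j) *\<^sub>R (0, axis j 1))" for d
    have "(\<Sum>k\<in>UNIV. (case \<tau> k of None \<Rightarrow> fst v | Some j \<Rightarrow> snd v $ j) *\<^sub>R e k) = (\<Sum>k\<in>UNIV. b (\<tau> k))"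
      by (rule sum.cong) (auto simp: e_def b_def split: option.splits)
    also have "\<dots> = sum b UNIV"
      by (rule sum.reindex_bij_betw[OF \<tau>])
    also have "\<dots> = v"
      using basis_expansion[of "snd v"]
      by (simp add: sum_UNIV_option b_def prod_eq_iff fst_sum snd_sum scalar_mult_eq_scaleR)
    finally show ?thesis by metis
  qed
  show ?thesis
    by (rule volume_condition_frame_change[OF linear_frechet[OF smooth_F assms] linear_h[OF assms] spans frame])
qed

lemma convex_affine_normal_\<xi>: "convex_affine_normal M F \<xi>"
  unfolding convex_affine_normal_def affine_normal_def
  using smooth_\<xi> transversal_\<xi> h_nondegenerate equiaffine_\<xi> volume_condition h_positive_definite
  by (simp add: affine_metric_eq)

lemma F_has_vector_derivative:
  assumes "t \<in> I"
  shows "((\<lambda>r. F (r, u)) has_vector_derivative (\<gamma>\<^sub>1' t *\<^sub>R \<phi> u, \<gamma>\<^sub>2' t)) (at t)"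
  using smooth_on_DERIV[OF smooth(1) assms] smooth_on_DERIV[OF smooth(2) assms]
  by (auto simp: F_def has_real_derivative_iff_has_vector_derivative
      intro!: has_vector_derivative_Pair derivative_eq_intros)

end

section \<open>The functions \<open>\<mu>\<close> and \<open>\<nu>\<close>\<close>

text \<open>An interval of values meeting both closed half-lines contains 0. This is what permits
  one global sign in the equations.\<close>

lemma nonvanishing_constant_sign:
  fixes f :: "real \<Rightarrow> real"
  assumes "is_interval I" "continuous_on I f" "\<And>t. t \<in> I \<Longrightarrow> f t \<noteq> 0"
  shows "\<exists>\<sigma>\<in>{-1, 1}. \<forall>t\<in>I. \<sigma> * f t > 0"
proof (rule ccontr)
  assume no: "\<not> ?thesis"
  then obtain a where a: "a \<in> I" "f a \<ge> 0" by force
  from no obtain b where b: "b \<in> I" "f b \<le> 0" by force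
  have "is_interval (f ` I)"
    using connected_continuous_image[OF assms(2)] assms(1) by (simp add: is_interval_connected_1)
  then have "0 \<in> f ` I"
    using a b unfolding is_interval_1 by blast
  then show False using assms(3) by auto
qed

lemma warping_coefficients_exist:
  fixes \<gamma> \<delta> W :: "real \<Rightarrow> real"
  assumes I: "open I" "is_interval I" and sm: "smooth_on I \<gamma>" "smooth_on I \<delta>" "smooth_on I W"
    and nz: "\<And>t. t \<in> I \<Longrightarrow> \<gamma> t \<noteq> 0 \<and> \<delta> t \<noteq> 0 \<and> W t \<noteq> 0" and "N > 0"
  obtains \<mu> \<nu> where "smooth_on I \<mu>" "smooth_on I \<nu>" "\<And>t. t \<in> I \<Longrightarrow> \<mu> t * \<delta> t * W t > 0"
    "\<And>t. t \<in> I \<Longrightarrow> deriv \<mu> t = - \<nu> t * (W t / \<delta> t)"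
    "\<And>t. t \<in> I \<Longrightarrow> \<bar>\<mu> t ^ N * \<gamma> t ^ m * \<delta> t ^ 3\<bar> = \<bar>W t\<bar>"
proof -
  have "continuous_on I (\<lambda>t. \<delta> t * W t)"
    by (intro smooth_on_continuous_on smooth_on_mult I sm)
  from nonvanishing_constant_sign[OF I(2) this] obtain \<sigma> :: real
    where \<sigma>: "\<sigma> \<in> {-1, 1}" "\<And>t. t \<in> I \<Longrightarrow> \<sigma> * (\<delta> t * W t) > 0"
    using nz by force
  \<comment> \<open>Squaring makes the radicand positive, so the root below is smooth; the exponent
    \<open>1 / (2 * real N)\<close> undoes the square as well. The factor \<sigma>, the sign of
    \<open>\<delta> * W\<close>, secures the required inequality.\<close>
  define R where "R t = (W t / (\<gamma> t ^ m * \<delta> t ^ 3))\<^sup>2" for t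
  define \<mu> where "\<mu> t = \<sigma> * R t powr (1 / (2 * real N))" for t
  \<comment> \<open>The derivative equation solved for \<nu>, which is possible because
    \<open>W\<close> has no zeros on \<open>I\<close>.\<close>
  define \<nu> where "\<nu> t = - deriv \<mu> t * \<delta> t / W t" for t
  have Rpos: "R t > 0" if "t \<in> I" for t
    using nz[OF that] by (simp add: R_def)
  have "smooth_on I R"
    unfolding R_def[abs_def] by (intro smooth_on_power smooth_on_divide smooth_on_mult I sm) (use nz in auto)
  then have smu: "smooth_on I \<mu>"
    unfolding \<mu>_def[abs_def] by (intro smooth_on_mult smooth_on_powr smooth_on_const I Rpos)
  then have snu: "smooth_on I \<nu>"
    unfolding \<nu>_def[abs_def]
    by (intro smooth_on_divide smooth_on_mult smooth_on_uminus smooth_on_deriv I sm) (use nz in auto)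
  show thesis
  proof (rule that[OF smu snu])
    fix t assume t: "t \<in> I"
    have "\<mu> t * \<delta> t * W t = (\<sigma> * (\<delta> t * W t)) * R t powr (1 / (2 * real N))"
      by (simp add: \<mu>_def)
    moreover have "(\<sigma> * (\<delta> t * W t)) * R t powr (1 / (2 * real N)) > 0"
      by (rule mult_pos_pos[OF \<sigma>(2)[OF t]]) (use Rpos[OF t] in simp)
    ultimately show "\<mu> t * \<delta> t * W t > 0"
      by (simp only:)
    show "deriv \<mu> t = - \<nu> t * (W t / \<delta> t)"
      using nz[OF t] by (simp add: \<nu>_def)
    have "\<bar>\<mu> t\<bar> ^ N = (R t powr (1 / (2 * real N))) powr real N"
      using \<sigma>(1) Rpos[OF t] by (auto simp: \<mu>_def powr_realpow)
    also have "\<dots> = sqrt (R t)"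
      using \<open>N > 0\<close> Rpos[OF t] by (simp add: powr_powr powr_half_sqrt)
    also have "\<dots> = \<bar>W t\<bar> / \<bar>\<gamma> t ^ m * \<delta> t ^ 3\<bar>"
      by (simp add: R_def)
    finally show "\<bar>\<mu> t ^ N * \<gamma> t ^ m * \<delta> t ^ 3\<bar> = \<bar>W t\<bar>"
      using nz[OF t] by (simp add: abs_mult power_abs)
  qed
qed

text \<open>The algebraic equation determines \<mu> up to sign at each point; continuity makes the
  sign uniform, and the derivative equation carries it over to \<nu>.\<close>

lemma warping_coefficients_unique:
  fixes \<gamma> \<delta> W :: "real \<Rightarrow> real"
  assumes I: "open I" "is_interval I" and sm: "smooth_on I \<mu>" "smooth_on I \<mu>'"
    and nz: "\<And>t. t \<in> I \<Longrightarrow> \<gamma> t \<noteq> 0 \<and> \<delta> t \<noteq> 0 \<and> W t \<noteq> 0" and "N > 0"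
    and deriv: "\<And>t. t \<in> I \<Longrightarrow> deriv \<mu> t = - \<nu> t * (W t / \<delta> t)"
      "\<And>t. t \<in> I \<Longrightarrow> deriv \<mu>' t = - \<nu>' t * (W t / \<delta> t)"
    and abs: "\<And>t. t \<in> I \<Longrightarrow> \<bar>\<mu> t ^ N * \<gamma> t ^ m * \<delta> t ^ 3\<bar> = \<bar>W t\<bar>"
      "\<And>t. t \<in> I \<Longrightarrow> \<bar>\<mu>' t ^ N * \<gamma> t ^ m * \<delta> t ^ 3\<bar> = \<bar>W t\<bar>"
  shows "(\<forall>t\<in>I. \<mu>' t = \<mu> t \<and> \<nu>' t = \<nu> t) \<or> (\<forall>t\<in>I. \<mu>' t = - \<mu> t \<and> \<nu>' t = - \<nu> t)"
proof -
  have abs_eq: "\<bar>\<mu>' t\<bar> = \<bar>\<mu> t\<bar>" if "t \<in> I" for t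
  proof -
    have "\<bar>\<mu>' t\<bar> ^ N * \<bar>\<gamma> t ^ m * \<delta> t ^ 3\<bar> = \<bar>\<mu> t\<bar> ^ N * \<bar>\<gamma> t ^ m * \<delta> t ^ 3\<bar>"
      using abs[OF that] by (simp add: abs_mult power_abs mult.assoc)
    then have "\<bar>\<mu>' t\<bar> ^ N = \<bar>\<mu> t\<bar> ^ N"
      using nz[OF that] by simp
    then show ?thesis
      using \<open>N > 0\<close> by (metis abs_ge_zero power_eq_imp_eq_base)
  qed
  have nz\<mu>: "\<mu> t \<noteq> 0" if "t \<in> I" for t
    using abs(1)[OF that] nz[OF that] \<open>N > 0\<close> by (auto simp: power_0_left)
  have "continuous_on I (\<lambda>t. \<mu> t * \<mu>' t)"
    by (intro smooth_on_continuous_on smooth_on_mult I sm)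
  moreover have "\<mu> t * \<mu>' t \<noteq> 0" if "t \<in> I" for t
    using abs_eq[OF that] nz\<mu>[OF that] by auto
  ultimately obtain \<sigma> :: real where \<sigma>: "\<sigma> \<in> {-1, 1}" "\<And>t. t \<in> I \<Longrightarrow> \<sigma> * (\<mu> t * \<mu>' t) > 0"
    using nonvanishing_constant_sign[OF I(2), of "\<lambda>t. \<mu> t * \<mu>' t"] by blast
  have \<mu>': "\<mu>' t = \<sigma> * \<mu> t" if "t \<in> I" for t
    using \<sigma>(1) \<sigma>(2)[OF that] abs_eq[OF that]
    by (auto simp: abs_eq_iff zero_less_mult_iff mult_less_0_iff)
  have \<nu>': "\<nu>' t = \<sigma> * \<nu> t" if "t \<in> I" for t
  proof -
    have "((\<lambda>t. \<sigma> * \<mu> t) has_real_derivative \<sigma> * deriv \<mu> t) (at t)"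
      by (rule DERIV_cmult[OF smooth_on_DERIV[OF sm(1) that]])
    then have "(\<mu>' has_real_derivative \<sigma> * deriv \<mu> t) (at t)"
      by (rule has_field_derivative_transform_within_open[OF _ I(1) that]) (simp add: \<mu>')
    then have "deriv \<mu>' t = \<sigma> * deriv \<mu> t"
      by (rule DERIV_imp_deriv)
    then have "\<nu>' t * (W t / \<delta> t) = \<sigma> * \<nu> t * (W t / \<delta> t)"
      using deriv[OF that] by simp
    then show ?thesis
      using nz[OF that] by simp
  qed
  show ?thesis
    using \<sigma>(1) \<mu>' \<nu>' by auto
qed

theorem theorem3p2:
  fixes \<phi> :: "real ^ 'm \<Rightarrow> real ^ 'n" and U :: "(real ^ 'm) set"
    and \<gamma>\<^sub>1 \<gamma>\<^sub>2 :: "real \<Rightarrow> real" and I :: "real set" and \<epsilon> :: real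
  assumes "CARD('n) \<ge> 3" and "CARD('n) = CARD('m) + 1"
    and "\<epsilon> \<in> {-1, 1}"
    and "open U" and "eps_quadric \<epsilon> U \<phi>"
    and "open I" and "is_interval I"
    and "smooth_on I \<gamma>\<^sub>1" and "smooth_on I \<gamma>\<^sub>2"
    and "\<And>t. t \<in> I \<Longrightarrow> \<epsilon> * deriv \<gamma>\<^sub>2 t * \<gamma>\<^sub>1 t *
           (deriv (deriv \<gamma>\<^sub>1) t * deriv \<gamma>\<^sub>2 t - deriv (deriv \<gamma>\<^sub>2) t * deriv \<gamma>\<^sub>1 t) < 0"
  shows "let n = CARD('n);
             F = (\<lambda>(t, u). (\<gamma>\<^sub>1 t *\<^sub>R \<phi> u, \<gamma>\<^sub>2 t));
             F\<^sub>t = (\<lambda>(t, u). (deriv \<gamma>\<^sub>1 t *\<^sub>R \<phi> u, deriv \<gamma>\<^sub>2 t));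
             \<xi> = (\<lambda>\<mu> \<nu> (t, u). \<mu> t *\<^sub>R (\<phi> u, 0) + \<nu> t *\<^sub>R F\<^sub>t (t, u));
             W = (\<lambda>t. deriv (deriv \<gamma>\<^sub>1) t * deriv \<gamma>\<^sub>2 t - deriv (deriv \<gamma>\<^sub>2) t * deriv \<gamma>\<^sub>1 t);
             eqs = (\<lambda>(s::real) \<mu> \<nu>. \<forall>t\<in>I. deriv \<mu> t = - \<nu> t * (W t / deriv \<gamma>\<^sub>2 t) \<and>
                      \<mu> t ^ (n + 2) * \<gamma>\<^sub>1 t ^ (n - 1) * deriv \<gamma>\<^sub>2 t ^ 3 = s * \<epsilon> ^ (n - 1) * W t)
         in convex_hypersurface (I \<times> U) F \<and>
            (\<forall>t\<in>I. \<forall>u\<in>U. ((\<lambda>r. F (r, u)) has_vector_derivative F\<^sub>t (t, u)) (at t)) \<and>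
            (\<exists>\<mu> \<nu>. smooth_on I \<mu> \<and> smooth_on I \<nu> \<and>
               (\<exists>s\<in>{-1, 1}. eqs s \<mu> \<nu>) \<and>
               convex_affine_normal (I \<times> U) F (\<xi> \<mu> \<nu>) \<and>
               pointwise_SO_symmetric (I \<times> U) F (\<xi> \<mu> \<nu>) \<and>
               (\<forall>\<mu>' \<nu>'. smooth_on I \<mu>' \<and> smooth_on I \<nu>' \<and> (\<exists>s\<in>{-1, 1}. eqs s \<mu>' \<nu>') \<longrightarrow>
                  (\<forall>t\<in>I. \<mu>' t = \<mu> t \<and> \<nu>' t = \<nu> t) \<or>
                  (\<forall>t\<in>I. \<mu>' t = - \<mu> t \<and> \<nu>' t = - \<nu> t)))"
proof -
  let ?W = "\<lambda>t. deriv (deriv \<gamma>\<^sub>1) t * deriv \<gamma>\<^sub>2 t - deriv (deriv \<gamma>\<^sub>2) t * deriv \<gamma>\<^sub>1 t"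
  let ?n = "CARD('n)"
  let ?L = "\<lambda>\<mu> t. \<mu> t ^ (?n + 2) * \<gamma>\<^sub>1 t ^ (?n - 1) * deriv \<gamma>\<^sub>2 t ^ 3"
  have smd: "smooth_on I (deriv \<gamma>\<^sub>1)" "smooth_on I (deriv \<gamma>\<^sub>2)"
    "smooth_on I (deriv (deriv \<gamma>\<^sub>1))" "smooth_on I (deriv (deriv \<gamma>\<^sub>2))"
    by (intro smooth_on_deriv assms)+
  have smW: "smooth_on I ?W"
    by (intro smooth_on_diff smooth_on_mult smd assms)
  have nz: "\<gamma>\<^sub>1 t \<noteq> 0 \<and> deriv \<gamma>\<^sub>2 t \<noteq> 0 \<and> ?W t \<noteq> 0" if "t \<in> I" for t
    using assms(10)[OF that] by auto
  obtain \<mu> \<nu> where sm: "smooth_on I \<mu>" "smooth_on I \<nu>" and sign: "\<And>t. t \<in> I \<Longrightarrow> \<mu> t * deriv \<gamma>\<^sub>2 t * ?W t > 0"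
    and deriv: "\<And>t. t \<in> I \<Longrightarrow> deriv \<mu> t = - \<nu> t * (?W t / deriv \<gamma>\<^sub>2 t)"
    and abs: "\<And>t. t \<in> I \<Longrightarrow> \<bar>?L \<mu> t\<bar> = \<bar>?W t\<bar>"
    by (rule warping_coefficients_exist[OF assms(6,7,8) smd(2) smW nz, of "?n + 2" "?n - 1"]) (assumption, simp, rule that)
  obtain G :: "real ^ 'n ^ 'n" where G: "\<bar>det G\<bar> = 1" "\<And>x y. x \<bullet> (G *v y) = y \<bullet> (G *v x)"
    "\<And>u. u \<in> U \<Longrightarrow> \<phi> u \<bullet> (G *v \<phi> u) = \<epsilon>"
    "\<And>u y. u \<in> U \<Longrightarrow> \<phi> u \<bullet> (G *v y) = 0 \<Longrightarrow> y \<noteq> 0 \<Longrightarrow> y \<bullet> (G *v y) > 0"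
    using eps_quadric_form[OF assms(5)] by blast
  have imm: "immersion_on U \<phi>"
    using assms(5) unfolding eps_quadric_def by blast
  interpret warped_quadric \<phi> U G \<epsilon> \<gamma>\<^sub>1 \<gamma>\<^sub>2 \<mu> \<nu> I
    by unfold_locales (assumption | rule assms imm G sm sign deriv abs)+
  have F_eq: "(\<lambda>(t, u). (\<gamma>\<^sub>1 t *\<^sub>R \<phi> u, \<gamma>\<^sub>2 t)) = F"
    by (auto simp: F_def)
  have \<xi>_eq: "(\<lambda>(t, u). \<mu> t *\<^sub>R (\<phi> u, 0) + \<nu> t *\<^sub>R (deriv \<gamma>\<^sub>1 t *\<^sub>R \<phi> u, deriv \<gamma>\<^sub>2 t)) = \<xi>"
    by (auto simp: \<xi>_def)
  have eps_pow: "\<epsilon> ^ k * \<epsilon> ^ k = 1" "\<bar>\<epsilon> ^ k\<bar> = 1" for k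
    using assms(3) by (auto simp: power_abs simp flip: power_mult_distrib)
  have "\<exists>s\<in>{-1, 1}. \<forall>t\<in>I. ?L \<mu> t = s * \<epsilon> ^ (?n - 1) * ?W t"
  proof -
    have "continuous_on I (\<lambda>t. ?L \<mu> t * ?W t)"
      by (intro smooth_on_continuous_on smooth_on_mult smooth_on_power smW smd sm assms)
    moreover have "?L \<mu> t * ?W t \<noteq> 0" if "t \<in> I" for t
      using abs[OF that] nz[OF that] by auto
    ultimately obtain \<sigma> :: real where \<sigma>: "\<sigma> \<in> {-1, 1}" "\<And>t. t \<in> I \<Longrightarrow> \<sigma> * (?L \<mu> t * ?W t) > 0"
      using nonvanishing_constant_sign[OF assms(7), of "\<lambda>t. ?L \<mu> t * ?W t"] by blast
    have "?L \<mu> t = \<sigma> * ?W t" if "t \<in> I" for t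
    proof -
      define x y where "x = ?L \<mu> t" and "y = ?W t"
      have "\<bar>x\<bar> = \<bar>y\<bar>" "\<sigma> * (x * y) > 0"
        using abs[OF that] \<sigma>(2)[OF that] by (simp_all add: x_def y_def)
      then have "x = \<sigma> * y"
        using \<sigma>(1) by (auto simp: abs_eq_iff zero_less_mult_iff mult_less_0_iff)
      then show ?thesis by (simp add: x_def y_def)
    qed
    \<comment> \<open>The power of \<epsilon> is itself a sign, so the constant sign \<sigma> is put
      into the required form with \<open>s = \<sigma> * \<epsilon> ^ (?n - 1)\<close>.\<close>
    moreover have "\<sigma> = (\<sigma> * \<epsilon> ^ (?n - 1)) * \<epsilon> ^ (?n - 1)"
      using eps_pow(1) by (simp add: mult.assoc)
    moreover have "\<sigma> * \<epsilon> ^ (?n - 1) \<in> {-1, 1}"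
      using \<sigma>(1) eps_pow(2)[of "?n - 1"] by (auto simp: abs_if split: if_splits)
    ultimately show ?thesis by metis
  qed
  then have eqs: "\<exists>s\<in>{-1, 1}. \<forall>t\<in>I. deriv \<mu> t = - \<nu> t * (?W t / deriv \<gamma>\<^sub>2 t) \<and> ?L \<mu> t = s * \<epsilon> ^ (?n - 1) * ?W t"
    using deriv by blast
  \<comment> \<open>Absolute values erase \<open>s\<close>, so competitors satisfying the equations
    with either sign are covered.\<close>
  have uniq: "(\<forall>t\<in>I. \<mu>' t = \<mu> t \<and> \<nu>' t = \<nu> t) \<or> (\<forall>t\<in>I. \<mu>' t = - \<mu> t \<and> \<nu>' t = - \<nu> t)"
    if "smooth_on I \<mu>'" "s \<in> {-1, 1}"
      "\<forall>t\<in>I. deriv \<mu>' t = - \<nu>' t * (?W t / deriv \<gamma>\<^sub>2 t) \<and> ?L \<mu>' t = s * \<epsilon> ^ (?n - 1) * ?W t" for \<mu>' \<nu>' s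
  proof (rule warping_coefficients_unique[OF assms(6,7) sm(1) that(1) nz _ deriv _ abs])
    fix t assume "t \<in> I"
    then have "?L \<mu>' t = s * \<epsilon> ^ (?n - 1) * ?W t" using that(3) by blast
    then show "\<bar>?L \<mu>' t\<bar> = \<bar>?W t\<bar>"
      using that(2) eps_pow(2) by (auto simp: abs_mult)
  qed (use that(3) in auto)
  show ?thesis
    unfolding Let_def prod.case F_eq
    by (intro conjI ballI allI impI convex_hypersurface_F F_has_vector_derivative
        exI[of _ \<mu>, OF exI[of _ \<nu>]], unfold \<xi>_eq)
      (assumption | rule sm eqs convex_affine_normal_\<xi> pointwise_SO_symmetric_F | elim conjE bexE, rule uniq)+
qed

end
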